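(* Let $-1\le A<B\le1$, $\alpha\in[0,1)$, $\beta\in(-\frac\pi2,\frac\pi2)$ and $g(\zeta)=\frac{1+A\zeta}{1+B\zeta}$, $\zeta\in\mathbb D$. Let $f\in\widehat{\mathcal S}_g^{\alpha,\beta}(\mathbb B^n)$. Put $T=A-A\alpha+B\alpha$ and, for $z\in\mathbb B^n$, $$\digamma_1=\left(\tfrac{1+A\|z\|}{1+B\|z\|}-\tfrac{1}{1-\alpha}\sqrt{\alpha^2+\tan^2\beta}\right)(1-\alpha)\cos\beta,\qquad \digamma_2=\left(\tfrac{1-A\|z\|}{1-B\|z\|}+\tfrac{1}{1-\alpha}\sqrt{\alpha^2+\tan^2\beta}\right)(1-\alpha)\cos\beta.$$ (1) If $z\in\mathbb B^n\setminus\{0\}$ satisfies $\|f(z)\|=\max_{\|\xi\|=\|z\|}\|f(\xi)\|$, then $$|\det J_f(z)|\le\begin{cases}[1+(A-A\alpha+B\alpha)\|z\|]^{\frac{n(B-A)(1-\alpha)}{A-A\alpha+B\alpha}}\left(\frac1{\digamma_1}\right)^{\frac{n+1}{2}},&T\ne0,\\ e^{n(B-A)(1-\alpha)\|z\|}\left(\frac1{\digamma_1}\right)^{\frac{n+1}{2}},&T=0,\end{cases}$$ and for every $\delta\in T_z^{(1,0)}(\partial\mathbb B^n(0,\|z\|))$ $$\|J_f(z)\delta\|\le\begin{cases}[1+(A-A\alpha+B\alpha)\|z\|]^{\frac{(B-A)(1-\alpha)}{A-A\alpha+B\alpha}}\left(\frac1{\digamma_1}\right)^{\frac12}\|\delta\|,&T\ne0,\\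 e^{(B-A)(1-\alpha)\|z\|}\left(\frac1{\digamma_1}\right)^{\frac12}\|\delta\|,&T=0.\end{cases}$$ (2) If $z\in\mathbb B^n\setminus\{0\}$ satisfies $\|f(z)\|=\min_{\|\xi\|=\|z\|}\|f(\xi)\|$, then $$|\det J_f(z)|\ge\begin{cases}[1+(A\alpha-A-B\alpha)\|z\|]^{\frac{n(A-B)(1-\alpha)}{A\alpha-B\alpha-A}}\digamma_2^{-\frac{n+1}{2}},&T\ne0,\\ e^{n(A-B)(1-\alpha)\|z\|}\digamma_2^{-\frac{n+1}{2}},&T=0,\end{cases}$$ and for every $\delta\in T_z^{(1,0)}(\partial\mathbb B^n(0,\|z\|))$ $$\|J_f(z)\delta\|\ge\begin{cases}[1+(A\alpha-A-B\alpha)\|z\|]^{\frac{(A-B)(1-\alpha)}{A\alpha-B\alpha-A}}\digamma_2^{-\frac12}\|\delta\|,&T\ne0,\\ e^{(A-B)(1-\alpha)\|z\|}\digamma_2^{-\frac12}\|\delta\|,&T=0.\end{cases}$$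
   Context: $\mathbb B^n$ is the open Euclidean unit ball of $\mathbb C^n$ with inner product $\langle z,w\rangle=\sum_j z_j\overline{w_j}$ and norm $\|z\|=\sqrt{\langle z,z\rangle}$; $\mathbb D=\mathbb B^1$; $\partial\mathbb B^n(0,r)=\{z:\|z\|=r\}$. $H(\mathbb B^n)$ is the set of holomorphic mappings $\mathbb B^n\to\mathbb C^n$; $J_f(z)$ is the complex Jacobian matrix of $f$ at $z$; $I_n$ is the identity matrix. Holomorphic tangent space: for $z\ne0$, $T_z^{(1,0)}(\partial\mathbb B^n(0,\|z\|))=\{w\in\mathbb C^n:\ \sum_j\overline{z_j}w_j=0\}$. For $\alpha\in[0,1)$, $\beta\in(-\frac\pi2,\frac\pi2)$, with $i=\sqrt{-1}$, $\widetilde{\mathcal M}_g^{\alpha,\beta}$ is the set of $h\in H(\mathbb B^n)$ with $h(0)=0$, $J_h(0)=I_n$ and $$\frac{-\alpha+i\tan\beta}{1-\alpha}+\frac{1-i\tan\beta}{1-\alpha}\left\langle h(z),\frac{z}{\|z\|^2}\right\rangle\in g(\mathbb D)\quad\text{for all } z\in\mathbb B^n\setminus\{0\}.$$ $\widehat{\mathcal S}_g^{\alpha,\beta}(\mathbb B^n)$ is the set of $f\in H(\mathbb B^n)$ with $f(0)=0$, $J_f(0)=I_n$, $J_f(z)$ nonsingular at every $z\in\mathbb B^n$, such that the mapping $z\mapsto [J_f(z)]^{-1}f(z)$ belongs to $\widetilde{\mathcal M}_g^{\alpha,\beta}$.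
   Formalization: Part (1) is stated only when ϝ₁ > 0: otherwise (1/ϝ₁)^{1/2} is undefined, and for n = 1, f(z) = z, α = 0, β near π/2 one has ϝ₁ < 0 and the determinant bound fails. *)

theory Defs
  imports "HOL-Analysis.Analysis"
begin

definition hinner :: "complex^'n \<Rightarrow> complex^'n \<Rightarrow> complex" where
  "hinner z w = (\<Sum>j\<in>UNIV. z $ j * cnj (w $ j))"

text \<open>Holomorphy is complex Frechet differentiability: the real derivative is given by a
  complex matrix. Mappings are total functions; only their values on the unit ball matter.\<close>

definition holomorphic_ball :: "(complex^'n \<Rightarrow> complex^'n) \<Rightarrow> bool" where
  "holomorphic_ball f \<longleftrightarrow> (\<forall>z\<in>ball 0 1. \<exists>M. (f has_derivative (\<lambda>v. M *v v)) (at z))"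

text \<open>Complex analogue of \<^const>\<open>jacobian\<close>: where \<open>f\<close> is complex differentiable, the
  derivative in direction \<open>axis j 1\<close> is the complex partial derivative in the \<open>j\<close>-th variable.\<close>

definition cjacobian :: "(complex^'n \<Rightarrow> complex^'n) \<Rightarrow> complex^'n \<Rightarrow> complex^'n^'n" where
  "cjacobian f z = matrix (frechet_derivative f (at z))"

lemma cjacobian_eq:
  assumes "(f has_derivative (\<lambda>v. M *v v)) (at z)"
  shows "cjacobian f z = M"
proof -
  have "frechet_derivative f (at z) = (\<lambda>v. M *v v)"
    using frechet_derivative_at[OF assms] by simp
  then show ?thesis
    by (simp add: cjacobian_def matrix_of_matrix_vector_mul)
qed

text \<open>\<open>hol_tangent z\<close> is the holomorphic tangent space at \<open>z \<noteq> 0\<close> of the sphere of radius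
  \<open>norm z\<close> about the origin.\<close>

definition hol_tangent :: "complex^'n \<Rightarrow> (complex^'n) set" where
  "hol_tangent z = {w. (\<Sum>j\<in>UNIV. cnj (z $ j) * w $ j) = 0}"

definition M_class :: "(complex \<Rightarrow> complex) \<Rightarrow> real \<Rightarrow> real \<Rightarrow> (complex^'n \<Rightarrow> complex^'n) set" where
  "M_class g \<alpha> \<beta> = {h. holomorphic_ball h \<and> h 0 = 0 \<and> cjacobian h 0 = mat 1 \<and>
     (\<forall>z\<in>ball 0 1 - {0}.
        (- of_real \<alpha> + \<i> * of_real (tan \<beta>)) / of_real (1 - \<alpha>)
        + (1 - \<i> * of_real (tan \<beta>)) / of_real (1 - \<alpha>) * hinner (h z) (z /\<^sub>R (norm z)\<^sup>2)
        \<in> g ` ball 0 1)}"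

definition S_class :: "(complex \<Rightarrow> complex) \<Rightarrow> real \<Rightarrow> real \<Rightarrow> (complex^'n \<Rightarrow> complex^'n) set" where
  "S_class g \<alpha> \<beta> = {f. holomorphic_ball f \<and> f 0 = 0 \<and> cjacobian f 0 = mat 1 \<and>
     (\<forall>z\<in>ball 0 1. invertible (cjacobian f z)) \<and>
     (\<lambda>z. matrix_inv (cjacobian f z) *v f z) \<in> M_class g \<alpha> \<beta>}"

text \<open>In the next two definitions \<open>r\<close> stands for \<open>norm z\<close>. \<open>digamma1\<close> can be nonpositive
  (e.g. for \<open>\<beta>\<close> near \<open>pi / 2\<close>), and then the real powers \<open>(1 / digamma1) powr _\<close> have no
  mathematical meaning, so bounds involving them are stated for \<open>digamma1 > 0\<close>.\<close>

definition digamma1 :: "real \<Rightarrow> real \<Rightarrow> real \<Rightarrow> real \<Rightarrow> real \<Rightarrow> real" where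
  "digamma1 A B \<alpha> \<beta> r =
     ((1 + A * r) / (1 + B * r) - 1 / (1 - \<alpha>) * sqrt (\<alpha>\<^sup>2 + (tan \<beta>)\<^sup>2)) * (1 - \<alpha>) * cos \<beta>"

definition digamma2 :: "real \<Rightarrow> real \<Rightarrow> real \<Rightarrow> real \<Rightarrow> real \<Rightarrow> real" where
  "digamma2 A B \<alpha> \<beta> r =
     ((1 - A * r) / (1 - B * r) + 1 / (1 - \<alpha>) * sqrt (\<alpha>\<^sup>2 + (tan \<beta>)\<^sup>2)) * (1 - \<alpha>) * cos \<beta>"

end

theory Submission
  imports Defs "HOL-Complex_Analysis.Conformal_Mappings"
begin

text \<open>Put \<open>p = \<langle>h(z), z\<rangle> / \<parallel>z\<parallel>\<^sup>2\<close> with \<open>h = J\<^sup>-\<^sup>1 f\<close>. The Schwarz lemma on the slices \<open>\<zeta> \<mapsto> \<zeta> u\<close> places the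
  affine image of \<open>p\<close> in the disc \<open>g ` cball 0 \<parallel>z\<parallel>\<close>. At an extremum of \<open>\<parallel>f\<parallel>\<close> on a sphere the gradient
  \<open>J\<^sup>* f\<close> is a real multiple of \<open>z\<close>, hence \<open>p\<close> is real and bounded by the real end points of that disc.
  Maximising \<open>ln (\<parallel>f\<parallel> / \<parallel>x\<parallel>)\<close> minus a radial primitive over an annulus uses this at the maximum
  point only and yields the growth of \<open>\<parallel>f\<parallel>\<close>. The second-order condition at the extremum,
  averaged over complex rotations of the tangent vector so that \<open>D\<^sup>2 f\<close> drops out, bounds \<open>\<parallel>J \<delta>\<parallel>\<close> by
  \<open>\<parallel>f\<parallel> \<parallel>\<delta>\<parallel> / (\<parallel>z\<parallel> sqrt p)\<close>; the determinant follows because \<open>J\<close> maps \<open>z\<^sup>\<bottom>\<close> to \<open>f(z)\<^sup>\<bottom>\<close>.\<close>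

subsection \<open>Hermitian inner product and determinants\<close>

lemma hinner_diff_left: "hinner (x - y) w = hinner x w - hinner y w"
  by (simp add: hinner_def sum_subtractf left_diff_distrib)

lemma hinner_smult_left: "hinner (c *s x) w = c * hinner x w"
  by (simp add: hinner_def sum_distrib_left mult.assoc)

lemma hinner_smult_right: "hinner x (c *s w) = cnj c * hinner x w"
  by (simp add: hinner_def sum_distrib_left algebra_simps)

lemma scaleR_eq_smult: "r *\<^sub>R x = complex_of_real r *s (x :: complex^'n)"
  by (simp add: vec_eq_iff scaleR_conv_of_real[where 'a = complex])

lemma hinner_scaleR_left: "hinner (r *\<^sub>R x) w = of_real r * hinner x w"
  by (simp add: scaleR_eq_smult hinner_smult_left)

lemma hinner_scaleR_right: "hinner x (r *\<^sub>R w) = of_real r * hinner x w"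
  by (simp add: scaleR_eq_smult hinner_smult_right)

lemma cnj_hinner: "cnj (hinner x w) = hinner w x"
  by (simp add: hinner_def mult.commute)

lemma Re_hinner: "Re (hinner x w) = x \<bullet> w"
  by (simp add: hinner_def inner_vec_def inner_complex_def)

lemma hinner_self: "hinner x x = of_real ((norm x)\<^sup>2)"
proof -
  have "Im (hinner x x) = 0"
    by (simp add: hinner_def)
  moreover have "Re (hinner x x) = (norm x)\<^sup>2"
    by (simp add: Re_hinner power2_norm_eq_inner)
  ultimately show ?thesis
    by (simp add: complex_eq_iff)
qed

lemma bounded_linear_hinner_left: "bounded_linear (\<lambda>x. hinner x w)"
  unfolding hinner_def by (intro bounded_linear_sum bounded_linear_mult_const bounded_linear_vec_nth)

lemma norm_smult: "norm (c *s x) = cmod c * norm (x :: complex^'n)"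
proof -
  have "of_real ((norm (c *s x))\<^sup>2) = complex_of_real ((cmod c * norm x)\<^sup>2)"
    by (simp add: hinner_self[symmetric] hinner_smult_left hinner_smult_right power_mult_distrib
        complex_norm_square del: of_real_power flip: mult.assoc)
  then have "(norm (c *s x))\<^sup>2 = (cmod c * norm x)\<^sup>2"
    using of_real_eq_iff by blast
  then show ?thesis
    by (simp add: power2_eq_iff_nonneg)
qed

lemma bounded_linear_smult_left: "bounded_linear (\<lambda>c. c *s (x :: complex^'n))"
  by (rule bounded_linear_intro[where K = "norm x"])
    (simp_all add: vector_sadd_rdistrib norm_smult scaleR_eq_smult scaleR_conv_of_real[where 'a = complex])

lemma hol_tangent_iff: "w \<in> hol_tangent z \<longleftrightarrow> hinner w z = 0"
  by (simp add: hol_tangent_def hinner_def mult.commute)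

text \<open>Conjugation by \<open>Q\<close>, the identity with column \<open>k\<close> replaced by
  \<open>a\<close>, turns the rank-one update into a change of row \<open>k\<close> alone, whose
  determinant Cramer's lemma reads off. Choosing \<open>k\<close> with \<open>a $ k\<close> nonzero
  lets \<open>det Q\<close> cancel.\<close>

lemma det_mat_1_plus_rank_one:
  fixes a b :: "'a::field ^ 'n"
  shows "det (mat 1 + (\<chi> i j. a $ i * b $ j)) = 1 + (\<Sum>i\<in>UNIV. a $ i * b $ i)"
proof (cases "a = 0")
  case True
  then have "mat 1 + (\<chi> i j. a $ i * b $ j) = (mat 1 :: 'a^'n^'n)"
    by (simp add: vec_eq_iff)
  with True show ?thesis
    by simp
next
  case False
  then obtain k where k: "a $ k \<noteq> 0"
    by (auto simp: vec_eq_iff)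
  define S :: "'a^'n^'n" where "S = mat 1 + (\<chi> i j. a $ i * b $ j)"
  define Q :: "'a^'n^'n" where "Q = (\<chi> i j. if j = k then a $ i else mat 1 $ i $ j)"
  define x where "x = axis k 1 + b v* Q"
  define P :: "'a^'n^'n" where "P = (\<chi> i j. if j = k then x $ i else mat 1 $ i $ j)"
  have detQ: "det Q = a $ k"
    using cramer_lemma[of k "mat 1" a] by (simp add: Q_def cong: if_cong)
  have detP: "det P = x $ k"
    using cramer_lemma[of k "mat 1" x] by (simp add: P_def cong: if_cong)
  have "S ** Q = Q ** transpose P"
  proof -
    have "S ** Q = mat 1 ** Q + (\<chi> i j. a $ i * b $ j) ** Q"
      by (simp add: S_def vec_eq_iff matrix_matrix_mult_def distrib_right sum.distrib)
    then have "(S ** Q) $ i $ j = Q $ i $ j + a $ i * (b v* Q) $ j" for i j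
      by (simp only: matrix_mul_lid)
        (simp add: matrix_matrix_mult_def vector_matrix_mult_def sum_distrib_left algebra_simps)
    moreover have "(Q ** transpose P) $ i $ j = Q $ i $ j + a $ i * (b v* Q) $ j" for i j
    proof -
      have "(\<Sum>l\<in>UNIV. Q $ i $ l * P $ j $ l)
          = (\<Sum>l\<in>UNIV. Q $ i $ l * (if j = l then 1 else 0) + (if l = k then Q $ i $ k * (b v* Q) $ j else 0))"
        by (rule sum.cong) (auto simp: P_def x_def mat_def axis_def algebra_simps)
      also have "\<dots> = Q $ i $ j + Q $ i $ k * (b v* Q) $ j"
        by (simp add: sum.distrib if_distrib[of "\<lambda>x. _ * x"] cong: if_cong)
      also have "\<dots> = Q $ i $ j + a $ i * (b v* Q) $ j"
        by (simp add: Q_def)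
      finally show ?thesis
        by (simp add: matrix_matrix_mult_def transpose_def)
    qed
    ultimately show ?thesis
      by (simp add: vec_eq_iff)
  qed
  then have "det S * a $ k = a $ k * x $ k"
    by (metis det_mul det_transpose detP detQ)
  then have "det S = x $ k"
    using k by simp
  also have "x $ k = 1 + (\<Sum>i\<in>UNIV. a $ i * b $ i)"
    by (simp add: x_def Q_def vector_matrix_mult_def mult.commute)
  finally show ?thesis
    by (simp add: S_def)
qed

section \<open>Determinants and operator norm bounds\<close>

lemma norm_axis_complex: "norm (axis j c :: complex^'n) = cmod c"
proof -
  have "(\<Sum>i\<in>UNIV. (cmod (axis j c $ i))\<^sup>2) = (\<Sum>i\<in>UNIV. if i = j then (cmod c)\<^sup>2 else 0)"
    by (rule sum.cong) (auto simp: axis_def)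
  then show ?thesis
    by (simp add: norm_vec_def L2_set_def)
qed

lemma cmod_component_le: "cmod (M $ i $ j) \<le> norm (M *v axis j (1::complex))"
proof -
  have "M $ i $ j = (M *v axis j 1) $ i"
    by (simp add: matrix_vector_mult_def axis_def if_distrib cong: if_cong)
  then show ?thesis
    by (simp add: Finite_Cartesian_Product.norm_nth_le)
qed

lemma cmod_det_le_fact:
  fixes M :: "complex^'n^'n"
  assumes "\<And>i j. cmod (M $ i $ j) \<le> 1"
  shows "cmod (det M) \<le> fact CARD('n)"
proof -
  have "cmod (det M) \<le> (\<Sum>p | p permutes (UNIV::'n set). 1)"
    unfolding det_def
  proof (rule sum_norm_le)
    fix p
    have "cmod (\<Prod>i\<in>UNIV. M $ i $ p i) \<le> 1"
      unfolding prod_norm[symmetric] by (rule prod_le_1) (auto simp: assms)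
    then show "cmod (of_int (sign p) * (\<Prod>i\<in>UNIV. M $ i $ p i)) \<le> 1"
      by (simp add: norm_mult sign_def)
  qed
  then show ?thesis
    by (simp add: card_permutations[OF refl])
qed

lemma power_bounded_imp_le_1:
  fixes x :: real
  assumes "\<And>k. x ^ k \<le> C"
  shows "x \<le> 1"
proof (rule ccontr)
  assume "\<not> x \<le> 1"
  then obtain k where "C < x ^ k"
    using real_arch_pow[of x C] by auto
  with assms[of k] show False
    by simp
qed

text \<open>All powers of a contraction have determinant at most \<open>n!\<close>.\<close>

lemma cmod_det_contraction_le_1:
  fixes M :: "complex^'n^'n"
  assumes "\<And>v. norm (M *v v) \<le> norm v"
  shows "cmod (det M) \<le> 1"
proof (rule power_bounded_imp_le_1)
  fix k
  define N where "N = ((\<lambda>X. M ** X) ^^ k) (mat 1)"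
  have "det N = det M ^ k"
    unfolding N_def by (induction k) (auto simp: det_mul)
  moreover have "norm (N *v v) \<le> norm v" for v
    unfolding N_def
    by (induction k) (auto simp: matrix_vector_mul_assoc[symmetric] intro: order.trans[OF assms])
  from this[of "axis j 1" for j] have "cmod (N $ i $ j) \<le> 1" for i j
    by (metis cmod_component_le norm_axis_complex norm_one order.trans)
  ultimately show "cmod (det M) ^ k \<le> fact CARD('n)"
    using cmod_det_le_fact[of N] by (simp add: norm_power)
qed

lemma smult_matrix_det:
  fixes M :: "complex^'n^'n"
  shows "det (\<chi> i. c *s (M $ i)) = c ^ CARD('n) * det M"
  using det_rows_mul[of "\<lambda>_. c" "\<lambda>i. M $ i"] by simp

text \<open>Scaling by \<open>inverse \<mu>\<close> reduces the claim to contractions.\<close>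

lemma cmod_det_le_power:
  fixes M :: "complex^'n^'n"
  assumes "\<mu> > 0" and "\<And>v. norm (M *v v) \<le> \<mu> * norm v"
  shows "cmod (det M) \<le> \<mu> ^ CARD('n)"
proof -
  define N where "N = (\<chi> i. complex_of_real (inverse \<mu>) *s (M $ i))"
  have "N *v v = complex_of_real (inverse \<mu>) *s (M *v v)" for v
    by (simp add: N_def vec_eq_iff matrix_vector_mult_def sum_distrib_left mult.assoc)
  then have "norm (N *v v) \<le> norm v" for v
    using assms by (simp add: norm_smult norm_inverse norm_divide field_simps)
  then have "cmod (det N) \<le> 1"
    by (rule cmod_det_contraction_le_1)
  then show ?thesis
    using assms(1) by (simp add: N_def smult_matrix_det norm_mult norm_power norm_inverse norm_divide field_simps)
qed

text \<open>The lower bound makes \<open>M\<close> injective, hence invertible, and bounds its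
  inverse by \<open>inverse \<mu>\<close>; the upper estimate for the inverse is then turned around
  by \<open>det M * det N = 1\<close>.\<close>

lemma cmod_det_ge_power:
  fixes M :: "complex^'n^'n"
  assumes "\<mu> > 0" and *: "\<And>v. norm (M *v v) \<ge> \<mu> * norm v"
  shows "cmod (det M) \<ge> \<mu> ^ CARD('n)"
proof -
  have "v = 0" if "M *v v = 0" for v
    using *[of v] that assms(1) by (simp add: mult_le_0_iff)
  then obtain N where "N ** M = mat 1"
    using matrix_left_invertible_ker[of M] by auto
  then have inv: "M ** N = mat 1" "det M * det N = 1"
    using matrix_left_right_inverse[of N M] det_mul[of N M] by (auto simp: mult.commute)
  have "norm (N *v v) \<le> inverse \<mu> * norm v" for v
    using *[of "N *v v"] assms(1) inv(1) by (simp add: matrix_vector_mul_assoc inverse_eq_divide pos_le_divide_eq mult.commute)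
  then have "cmod (det N) \<le> inverse \<mu> ^ CARD('n)"
    using assms(1) by (intro cmod_det_le_power) auto
  moreover have "cmod (det M) * cmod (det N) = 1"
    using inv(2) by (metis norm_mult norm_one)
  ultimately have "1 \<le> cmod (det M) * inverse \<mu> ^ CARD('n)"
    by (metis mult_left_mono norm_ge_zero)
  then have "\<mu> ^ CARD('n) * 1 \<le> \<mu> ^ CARD('n) * (cmod (det M) * inverse \<mu> ^ CARD('n))"
    using assms(1) by (intro mult_left_mono) auto
  also have "\<dots> = cmod (det M) * (\<mu> * inverse \<mu>) ^ CARD('n)"
    unfolding power_mult_distrib by simp
  finally show ?thesis
    using assms(1) by simp
qed

lemma Pythagoras_hinner:
  assumes "hinner x y = 0"
  shows "(norm (x + y))\<^sup>2 = (norm x)\<^sup>2 + (norm y)\<^sup>2"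
  using assms Re_hinner[of x y] by (simp add: orthogonal_def norm_add_Pythagorean)

text \<open>The rank-one modification \<open>S\<close> of the identity replaces the \<open>z\<close>-direction by the direction
  \<open>h\<close> with \<open>J h = u\<close>, so that \<open>J S\<close> maps the orthogonal splitting \<open>z\<^sup>\<bottom> \<oplus> \<complex> z\<close> to \<open>u\<^sup>\<bottom> \<oplus> \<complex> u\<close>.\<close>

lemma rank_one_modification:
  fixes J :: "complex^'n^'n" and z u h :: "complex^'n"
  assumes z: "z \<noteq> 0"
    and perp: "\<And>v. hinner v z = 0 \<Longrightarrow> hinner (J *v v) u = 0"
    and h: "J *v h = u" and p: "p > 0" "hinner h z = of_real (p * (norm z)\<^sup>2)"
  obtains S :: "complex^'n^'n" where "cmod (det S) = sqrt p"
    "\<And>v. \<exists>w t. hinner w z = 0 \<and> (norm v)\<^sup>2 = (norm w)\<^sup>2 + (t * norm z)\<^sup>2 \<and>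
        (norm ((J ** S) *v v))\<^sup>2 = (norm (J *v w))\<^sup>2 + t\<^sup>2 * (norm u)\<^sup>2 / p"
proof
  define c where "c = complex_of_real (1 / (norm z)\<^sup>2)"
  define s where "s = complex_of_real (1 / sqrt p)"
  \<comment> \<open>This choice makes \<open>S\<close> fix the complement of \<open>z\<close> and
    send \<open>z\<close> to \<open>s *s h\<close>. With \<open>s = 1 / sqrt p\<close>,
    \<open>J ** S\<close> stretches \<open>z\<close> by exactly
    \<open>norm u / (norm z * sqrt p)\<close>, the factor in the tangential estimates.\<close>
  define a where "a = c *s (s *s h - z)"
  define b where "b = (\<chi> j. cnj (z $ j))"
  define S where "S = mat 1 + (\<chi> i j. a $ i * b $ j)"
  have c: "c * hinner z z = 1"
    using z by (simp add: c_def hinner_self)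
  have "1 + (\<Sum>i\<in>UNIV. a $ i * b $ i) = 1 + hinner a z"
    by (simp add: hinner_def b_def)
  also have "\<dots> = s * (c * hinner h z)"
    using c by (simp add: a_def hinner_smult_left hinner_diff_left algebra_simps)
  also have "c * hinner h z = p"
    using z by (simp add: c_def p)
  also have "s * p = sqrt p"
  proof -
    have "1 / sqrt p * p = sqrt p"
      using p(1) real_div_sqrt[of p] by simp
    then show ?thesis
      unfolding s_def by (metis of_real_mult)
  qed
  finally show "cmod (det S) = sqrt p"
    using p(1) by (simp add: S_def det_mat_1_plus_rank_one)
  show "\<exists>w t. hinner w z = 0 \<and> (norm v)\<^sup>2 = (norm w)\<^sup>2 + (t * norm z)\<^sup>2 \<and>
        (norm ((J ** S) *v v))\<^sup>2 = (norm (J *v w))\<^sup>2 + t\<^sup>2 * (norm u)\<^sup>2 / p" for v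
  proof -
    define \<tau> where "\<tau> = c * hinner v z"
    define w where "w = v - \<tau> *s z"
    have w: "hinner w z = 0"
      using c by (simp add: w_def \<tau>_def hinner_diff_left hinner_smult_left algebra_simps)
    have "(\<chi> i j. a $ i * b $ j) *v v = hinner v z *s a"
      by (simp add: vec_eq_iff matrix_vector_mult_def hinner_def b_def sum_distrib_left algebra_simps)
    then have "S *v v = v + hinner v z *s a"
      by (simp add: S_def matrix_vector_mult_add_rdistrib)
    also have "\<dots> = w + (\<tau> * s) *s h"
      by (simp add: w_def a_def \<tau>_def vec_eq_iff algebra_simps)
    finally have "(J ** S) *v v = J *v w + (\<tau> * s) *s u"
      by (simp add: matrix_vector_mul_assoc[symmetric] matrix_vector_right_distrib vector_scalar_commute h)
    moreover have "hinner (J *v w) ((\<tau> * s) *s u) = 0"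
      using perp[OF w] by (simp add: hinner_smult_right)
    ultimately have "(norm ((J ** S) *v v))\<^sup>2 = (norm (J *v w))\<^sup>2 + (cmod \<tau>)\<^sup>2 * (norm u)\<^sup>2 / p"
      using p(1) by (simp add: Pythagoras_hinner norm_smult norm_mult s_def norm_divide power_mult_distrib power_divide)
    moreover have "(norm v)\<^sup>2 = (norm w)\<^sup>2 + (cmod \<tau> * norm z)\<^sup>2"
      using Pythagoras_hinner[of w "\<tau> *s z"] w by (simp add: w_def hinner_smult_right norm_smult)
    ultimately show ?thesis
      using w by blast
  qed
qed

text \<open>The tangential bound extends to all vectors once \<open>J\<close> is replaced by
  \<open>J ** S\<close>: the images of \<open>z\<close> and of its complement stay orthogonal, and
  \<open>z\<close> is stretched by the same factor \<open>\<mu>\<close>. The factor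
  \<open>sqrt p\<close> is the modulus of \<open>det S\<close>.\<close>

lemma extremal_det_le:
  fixes J :: "complex^'n^'n" and z u h :: "complex^'n"
  assumes z: "z \<noteq> 0" and u: "u \<noteq> 0"
    and perp: "\<And>v. hinner v z = 0 \<Longrightarrow> hinner (J *v v) u = 0"
    and h: "J *v h = u" and p: "p > 0" "hinner h z = of_real (p * (norm z)\<^sup>2)"
    and le: "\<And>v. hinner v z = 0 \<Longrightarrow> norm (J *v v) \<le> norm u / (norm z * sqrt p) * norm v"
  shows "cmod (det J) * sqrt p \<le> (norm u / (norm z * sqrt p)) ^ CARD('n)"
proof -
  define \<mu> where "\<mu> = norm u / (norm z * sqrt p)"
  have \<mu>: "\<mu> > 0" "\<mu>\<^sup>2 * (norm z)\<^sup>2 = (norm u)\<^sup>2 / p"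
    using z u p(1) by (simp_all add: \<mu>_def power_divide power_mult_distrib)
  obtain S :: "complex^'n^'n" where S: "cmod (det S) = sqrt p"
    "\<And>v. \<exists>w t. hinner w z = 0 \<and> (norm v)\<^sup>2 = (norm w)\<^sup>2 + (t * norm z)\<^sup>2 \<and>
        (norm ((J ** S) *v v))\<^sup>2 = (norm (J *v w))\<^sup>2 + t\<^sup>2 * (norm u)\<^sup>2 / p"
    using rank_one_modification[OF z perp h p] by blast
  have "norm ((J ** S) *v v) \<le> \<mu> * norm v" for v
  proof -
    obtain w t where w: "hinner w z = 0" "(norm v)\<^sup>2 = (norm w)\<^sup>2 + (t * norm z)\<^sup>2"
      and eq: "(norm ((J ** S) *v v))\<^sup>2 = (norm (J *v w))\<^sup>2 + t\<^sup>2 * (norm u)\<^sup>2 / p"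
      using S(2) by blast
    have "(norm (J *v w))\<^sup>2 \<le> (\<mu> * norm w)\<^sup>2"
      using le[OF w(1)] by (intro power_mono) (simp_all add: \<mu>_def)
    moreover have "t\<^sup>2 * (norm u)\<^sup>2 / p = \<mu>\<^sup>2 * (t * norm z)\<^sup>2"
      using arg_cong[OF \<mu>(2), of "(*) (t\<^sup>2)"] by (simp add: power_mult_distrib mult_ac)
    ultimately have "(norm ((J ** S) *v v))\<^sup>2 \<le> (\<mu> * norm v)\<^sup>2"
      by (simp add: eq w(2) power_mult_distrib distrib_left)
    then show ?thesis
      using \<mu>(1) by (simp add: power2_le_iff_abs_le)
  qed
  then have "cmod (det (J ** S)) \<le> \<mu> ^ CARD('n)"
    by (rule cmod_det_le_power[OF \<mu>(1)])
  then show ?thesis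
    by (simp add: det_mul norm_mult S(1) \<mu>_def)
qed

text \<open>Mirror image of the upper estimate: the same orthogonal splitting propagates a lower
  tangential bound to all vectors.\<close>

lemma extremal_det_ge:
  fixes J :: "complex^'n^'n" and z u h :: "complex^'n"
  assumes z: "z \<noteq> 0" and u: "u \<noteq> 0"
    and perp: "\<And>v. hinner v z = 0 \<Longrightarrow> hinner (J *v v) u = 0"
    and h: "J *v h = u" and p: "p > 0" "hinner h z = of_real (p * (norm z)\<^sup>2)"
    and ge: "\<And>v. hinner v z = 0 \<Longrightarrow> norm (J *v v) \<ge> norm u / (norm z * sqrt p) * norm v"
  shows "cmod (det J) * sqrt p \<ge> (norm u / (norm z * sqrt p)) ^ CARD('n)"
proof -
  define \<mu> where "\<mu> = norm u / (norm z * sqrt p)"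
  have \<mu>: "\<mu> > 0" "\<mu>\<^sup>2 * (norm z)\<^sup>2 = (norm u)\<^sup>2 / p"
    using z u p(1) by (simp_all add: \<mu>_def power_divide power_mult_distrib)
  obtain S :: "complex^'n^'n" where S: "cmod (det S) = sqrt p"
    "\<And>v. \<exists>w t. hinner w z = 0 \<and> (norm v)\<^sup>2 = (norm w)\<^sup>2 + (t * norm z)\<^sup>2 \<and>
        (norm ((J ** S) *v v))\<^sup>2 = (norm (J *v w))\<^sup>2 + t\<^sup>2 * (norm u)\<^sup>2 / p"
    using rank_one_modification[OF z perp h p] by blast
  have "norm ((J ** S) *v v) \<ge> \<mu> * norm v" for v
  proof -
    obtain w t where w: "hinner w z = 0" "(norm v)\<^sup>2 = (norm w)\<^sup>2 + (t * norm z)\<^sup>2"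
      and eq: "(norm ((J ** S) *v v))\<^sup>2 = (norm (J *v w))\<^sup>2 + t\<^sup>2 * (norm u)\<^sup>2 / p"
      using S(2) by blast
    have "(norm (J *v w))\<^sup>2 \<ge> (\<mu> * norm w)\<^sup>2"
      using ge[OF w(1)] \<mu>(1) by (intro power_mono) (simp_all add: \<mu>_def[symmetric])
    moreover have "t\<^sup>2 * (norm u)\<^sup>2 / p = \<mu>\<^sup>2 * (t * norm z)\<^sup>2"
      using arg_cong[OF \<mu>(2), of "(*) (t\<^sup>2)"] by (simp add: power_mult_distrib mult_ac)
    ultimately have "(norm ((J ** S) *v v))\<^sup>2 \<ge> (\<mu> * norm v)\<^sup>2"
      by (simp add: eq w(2) power_mult_distrib distrib_left)
    then show ?thesis
      by (rule power2_le_imp_le) simp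
  qed
  then have "cmod (det (J ** S)) \<ge> \<mu> ^ CARD('n)"
    by (rule cmod_det_ge_power[OF \<mu>(1)])
  then show ?thesis
    by (simp add: det_mul norm_mult S(1) \<mu>_def)
qed

subsection \<open>Schwarz lemma on slices\<close>

lemma one_plus_mult_pos:
  fixes A r :: real
  assumes "\<bar>A\<bar> \<le> 1" "0 \<le> r" "r < 1"
  shows "0 < 1 + A * r" "0 < 1 - A * r"
proof -
  have "\<bar>A\<bar> * r \<le> 1 * r"
    using assms by (intro mult_right_mono) auto
  then have "\<bar>A * r\<bar> < 1"
    using assms by (simp add: abs_mult)
  then show "0 < 1 + A * r" "0 < 1 - A * r"
    by (auto simp: abs_less_iff)
qed

text \<open>Applied to \<open>T\<close>, this keeps \<open>1 + T * r\<close> positive inside the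
  unit disc, so that the logarithms and real powers in the growth bounds make sense.\<close>

lemma abs_convex_combination_le_1:
  fixes A B \<alpha> :: real
  assumes "\<bar>A\<bar> \<le> 1" "\<bar>B\<bar> \<le> 1" "0 \<le> \<alpha>" "\<alpha> \<le> 1"
  shows "\<bar>A - A * \<alpha> + B * \<alpha>\<bar> \<le> 1"
proof -
  have "\<bar>A * (1 - \<alpha>) + B * \<alpha>\<bar> \<le> \<bar>A\<bar> * (1 - \<alpha>) + \<bar>B\<bar> * \<alpha>"
    using abs_triangle_ineq[of "A * (1 - \<alpha>)" "B * \<alpha>"] assms by (simp add: abs_mult)
  also have "\<dots> \<le> 1 * (1 - \<alpha>) + 1 * \<alpha>"
    using assms by (intro add_mono mult_right_mono) auto
  finally show ?thesis
    by (simp add: algebra_simps)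
qed

text \<open>Where \<open>w = g \<omega>\<close> with \<open>cmod \<omega> \<le> r\<close>, the premise says that \<open>w\<close> lies in the disc \<open>g ` cball 0 r\<close>,
  whose diameter on the real axis is \<open>{g r..g (- r)}\<close>.\<close>

lemma moebius_disc_bounds:
  fixes w :: complex and A B r :: real
  assumes AB: "- 1 \<le> A" "A < B" "B \<le> 1" and r: "0 \<le> r" "r < 1"
    and w: "cmod (1 - w) \<le> r * cmod (B * w - A)"
  shows "(1 + A * r) / (1 + B * r) \<le> Re w" "Re w \<le> (1 - A * r) / (1 - B * r)"
    "cmod w \<le> (1 - A * r) / (1 - B * r)"
proof -
  define x1 where "x1 = (1 + A * r) / (1 + B * r)"
  define x2 where "x2 = (1 - A * r) / (1 - B * r)"
  have pos: "0 < 1 + A * r" "0 < 1 - A * r" "0 < 1 + B * r" "0 < 1 - B * r"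
    using one_plus_mult_pos[of _ r] AB r by auto
  have x: "x1 > 0" "x2 > 0"
    using pos by (simp_all add: x1_def x2_def)
  have "A * r \<le> B * r"
    using AB r by (simp add: mult_right_mono)
  have "x1 \<le> 1"
    using pos \<open>A * r \<le> B * r\<close> by (simp add: x1_def)
  moreover have "1 \<le> x2"
    using pos \<open>A * r \<le> B * r\<close> by (simp add: x2_def)
  ultimately have "x1 \<le> x2"
    by simp
  have "(cmod (1 - w))\<^sup>2 \<le> r\<^sup>2 * (cmod (B * w - A))\<^sup>2"
    using power_mono[OF w, of 2] by (simp add: power_mult_distrib)
  then have "(1 - Re w)\<^sup>2 + (Im w)\<^sup>2 \<le> r\<^sup>2 * ((B * Re w - A)\<^sup>2 + (B * Im w)\<^sup>2)"
    by (simp add: cmod_power2)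
  moreover have "1 + A * r = (1 + B * r) * x1" "1 - A * r = (1 - B * r) * x2"
    using pos by (simp_all add: x1_def x2_def)
  \<comment> \<open>The terms without \<open>Im w\<close> are a difference of squares. Its two
    linear factors vanish at \<open>Re w = x1\<close> and \<open>Re w = x2\<close>, so the premise
    becomes the Thales inequality of the disc with these diameter end points.\<close>
  then have "(1 - B\<^sup>2 * r\<^sup>2) * ((Re w - x1) * (Re w - x2) + (Im w)\<^sup>2)
     = ((1 + B * r) * Re w - (1 + A * r)) * ((1 - B * r) * Re w - (1 - A * r))
       + (1 - B\<^sup>2 * r\<^sup>2) * (Im w)\<^sup>2"
    by (simp only:) (simp add: power2_eq_square algebra_simps)
  ultimately have "(1 - B\<^sup>2 * r\<^sup>2) * ((Re w - x1) * (Re w - x2) + (Im w)\<^sup>2) \<le> 0"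
    by (simp add: power2_eq_square algebra_simps)
  moreover have "1 - B\<^sup>2 * r\<^sup>2 = (1 + B * r) * (1 - B * r)"
    by (simp add: power2_eq_square algebra_simps)
  then have "1 - B\<^sup>2 * r\<^sup>2 > 0"
    using pos by simp
  ultimately have main: "(Re w - x1) * (Re w - x2) + (Im w)\<^sup>2 \<le> 0"
    by (simp add: mult_le_0_iff)
  then have "(Re w - x1) * (Re w - x2) \<le> 0"
    using zero_le_power2[of "Im w"] by linarith
  then have between: "x1 \<le> Re w" "Re w \<le> x2"
    using \<open>x1 \<le> x2\<close> by (auto simp: mult_le_0_iff)
  \<comment> \<open>The bound on \<open>(cmod w)^2\<close> is affine and increasing in
    \<open>Re w\<close>, hence largest at \<open>Re w = x2\<close>, where it equals
    \<open>x2^2\<close>.\<close>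
  have "(cmod w)\<^sup>2 \<le> Re w * (x1 + x2) - x1 * x2"
    using main unfolding cmod_power2 by (simp add: power2_eq_square algebra_simps)
  also have "\<dots> \<le> x2 * (x1 + x2) - x1 * x2"
    using between x by (simp add: mult_right_mono)
  also have "\<dots> = x2\<^sup>2"
    by (simp add: power2_eq_square algebra_simps)
  finally have "cmod w \<le> x2"
    using x by (simp add: power2_le_iff_abs_le)
  with between show "(1 + A * r) / (1 + B * r) \<le> Re w" "Re w \<le> (1 - A * r) / (1 - B * r)"
    "cmod w \<le> (1 - A * r) / (1 - B * r)"
    by (simp_all add: x1_def x2_def)
qed

text \<open>The function \<open>\<omega>\<close> is the inverse of the Moebius map \<open>g\<close>
  composed with \<open>q\<close>. It maps the disc into itself and fixes 0, so the Schwarz lemma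
  applies; clearing the denominator gives the stated form.\<close>

lemma Schwarz_Pick_moebius:
  fixes q g :: "complex \<Rightarrow> complex"
  assumes g: "\<And>\<zeta>. \<zeta> \<in> ball 0 1 \<Longrightarrow> g \<zeta> = (1 + of_real A * \<zeta>) / (1 + of_real B * \<zeta>)"
    and AB: "- 1 \<le> A" "A < B" "B \<le> 1"
    and q: "q holomorphic_on ball 0 1" "q 0 = 1" "\<And>\<zeta>. \<zeta> \<in> ball 0 1 \<Longrightarrow> q \<zeta> \<in> g ` ball 0 1"
    and \<zeta>: "\<zeta> \<in> ball 0 1"
  shows "cmod (1 - q \<zeta>) \<le> cmod \<zeta> * cmod (of_real B * q \<zeta> - of_real A)"
proof -
  define \<omega> where "\<omega> = (\<lambda>\<zeta>. (1 - q \<zeta>) / (of_real B * q \<zeta> - of_real A))"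
  have inv: "of_real B * q \<zeta> - of_real A \<noteq> 0 \<and> cmod (\<omega> \<zeta>) < 1" if \<zeta>: "\<zeta> \<in> ball 0 1" for \<zeta>
  proof -
    obtain \<eta> where \<eta>: "\<eta> \<in> ball 0 1" "q \<zeta> = g \<eta>"
      using q(3)[OF \<zeta>] by auto
    have "\<bar>B\<bar> * cmod \<eta> \<le> 1 * cmod \<eta>"
      using AB by (intro mult_right_mono) auto
    then have "cmod (of_real B * \<eta>) < 1"
      using \<eta>(1) by (simp add: norm_mult)
    then have nz: "1 + of_real B * \<eta> \<noteq> 0"
      by (metis add_eq_0_iff norm_minus_cancel norm_one less_irrefl)
    have BA: "of_real B - of_real A \<noteq> (0::complex)"
      using AB(2) by (simp flip: of_real_diff)
    have eq: "of_real B * q \<zeta> - of_real A = (of_real B - of_real A) / (1 + of_real B * \<eta>)"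
      unfolding \<eta>(2) g[OF \<eta>(1)] using nz by (simp add: field_simps)
    have "1 - q \<zeta> = (of_real B - of_real A) * \<eta> / (1 + of_real B * \<eta>)"
      unfolding \<eta>(2) g[OF \<eta>(1)] using nz by (simp add: field_simps)
    then have "\<omega> \<zeta> = \<eta>"
      unfolding \<omega>_def eq using nz BA by simp
    then show ?thesis
      using eq nz BA \<eta>(1) by simp
  qed
  have hol: "\<omega> holomorphic_on ball 0 1"
    unfolding \<omega>_def using inv by (intro holomorphic_intros q(1)) auto
  have "cmod (\<omega> \<zeta>) \<le> cmod \<zeta>"
    using \<zeta> inv by (intro Schwarz_Lemma(1)[OF hol]) (auto simp: \<omega>_def q(2))
  moreover have "1 - q \<zeta> = \<omega> \<zeta> * (of_real B * q \<zeta> - of_real A)"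
    using inv[OF \<zeta>] by (simp add: \<omega>_def)
  ultimately show ?thesis
    by (simp add: norm_mult mult_right_mono)
qed

text \<open>Gives access to one-variable function theory: along a complex line, complex linearity of
  the derivative makes every Hermitian coordinate of \<open>f\<close> holomorphic.\<close>

lemma has_field_derivative_hinner_slice:
  assumes "(f has_derivative (\<lambda>v. M *v v)) (at (a + \<zeta> *s b))"
  shows "((\<lambda>\<zeta>. hinner (f (a + \<zeta> *s b)) u) has_field_derivative hinner (M *v b) u) (at \<zeta>)"
proof -
  have "((\<lambda>\<zeta>. a + \<zeta> *s b) has_derivative (\<lambda>\<zeta>. \<zeta> *s b)) (at \<zeta>)"
    using bounded_linear_imp_has_derivative[OF bounded_linear_smult_left]
    by (auto intro!: derivative_eq_intros)
  from has_derivative_compose[OF this assms]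
  have "((\<lambda>\<zeta>. f (a + \<zeta> *s b)) has_derivative (\<lambda>\<zeta>. M *v (\<zeta> *s b))) (at \<zeta>)"
    by simp
  from bounded_linear.has_derivative[OF bounded_linear_hinner_left this, of u]
  moreover have "(*) (hinner (M *v b) u) = (\<lambda>x. hinner (M *v (x *s b)) u)"
    by (simp add: fun_eq_iff vector_scalar_commute hinner_smult_left mult.commute)
  ultimately show ?thesis
    unfolding has_field_derivative_def by simp
qed

text \<open>On the complex line through \<open>z\<close>, the coordinate \<open>k\<close> has a
  simple zero at 0 with derivative 1. Its quotient \<open>v\<close> by the variable is therefore
  holomorphic with \<open>v 0 = 1\<close>, and the affine image of \<open>v\<close> satisfies the
  premises of \<open>Schwarz_Pick_moebius\<close>, used at the point \<open>norm z\<close>.\<close>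

lemma M_class_Schwarz:
  fixes h :: "complex^'n \<Rightarrow> complex^'n"
  assumes g: "\<And>\<zeta>. \<zeta> \<in> ball 0 1 \<Longrightarrow> g \<zeta> = (1 + of_real A * \<zeta>) / (1 + of_real B * \<zeta>)"
    and AB: "- 1 \<le> A" "A < B" "B \<le> 1" and \<alpha>: "\<alpha> < 1"
    and h: "h \<in> M_class g \<alpha> \<beta>" and z: "z \<in> ball 0 1 - {0}"
    and p: "p = hinner (h z) z / of_real ((norm z)\<^sup>2)"
    and w: "w = (- of_real \<alpha> + \<i> * of_real (tan \<beta>)) / of_real (1 - \<alpha>)
        + (1 - \<i> * of_real (tan \<beta>)) / of_real (1 - \<alpha>) * p"
  shows "cmod (1 - w) \<le> norm z * cmod (of_real B * w - of_real A)"
proof -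
  define L where "L = (\<lambda>p. (- of_real \<alpha> + \<i> * of_real (tan \<beta>)) / of_real (1 - \<alpha>)
        + (1 - \<i> * of_real (tan \<beta>)) / of_real (1 - \<alpha>) * p)"
  define u where "u = (1 / norm z) *\<^sub>R z"
  have zu: "z = of_real (norm z) *s u" and u: "norm u = 1"
    using z by (simp_all add: u_def scaleR_eq_smult[symmetric])
  have ball: "\<zeta> *s u \<in> ball 0 1" if "\<zeta> \<in> ball 0 1" for \<zeta>
    using that u by (simp add: norm_smult)
  have holo: "holomorphic_ball h" and h0: "h 0 = 0" "cjacobian h 0 = mat 1"
    and img: "\<And>z. z \<in> ball 0 1 - {0} \<Longrightarrow> L (hinner (h z) (z /\<^sub>R (norm z)\<^sup>2)) \<in> g ` ball 0 1"
    using h by (auto simp: M_class_def L_def)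
  define k where "k = (\<lambda>\<zeta>. hinner (h (\<zeta> *s u)) u)"
  have der: "(k has_field_derivative hinner (cjacobian h (\<zeta> *s u) *v u) u) (at \<zeta>)" if \<zeta>: "\<zeta> \<in> ball 0 1" for \<zeta>
  proof -
    obtain M where "(h has_derivative (\<lambda>v. M *v v)) (at (\<zeta> *s u))"
      using holo ball[OF \<zeta>] unfolding holomorphic_ball_def by blast
    then show ?thesis
      using has_field_derivative_hinner_slice[of h M 0 \<zeta> u u] cjacobian_eq by (auto simp: k_def)
  qed
  then have "k holomorphic_on ball 0 1"
    by (metis holomorphic_on_open open_ball)
  moreover have "k 0 = 0"
    by (simp add: k_def h0 hinner_def)
  ultimately obtain v where v: "v holomorphic_on ball 0 1" "\<And>\<zeta>. cmod \<zeta> < 1 \<Longrightarrow> k \<zeta> = \<zeta> * v \<zeta>"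
    "deriv k 0 = v 0"
    by (rule Schwarz3) blast
  have "deriv k 0 = 1"
    using DERIV_imp_deriv[OF der[of 0]] u by (simp add: h0 hinner_self)
  with v have v0: "v 0 = 1"
    by simp
  \<comment> \<open>The normalised inner product in the class condition is exactly
    \<open>k \<zeta> / \<zeta>\<close>, since \<open>cnj \<zeta>\<close> cancels against
    \<open>(cmod \<zeta>)^2\<close>.\<close>
  have v_eq: "v \<zeta> = hinner (h (\<zeta> *s u)) ((\<zeta> *s u) /\<^sub>R (norm (\<zeta> *s u))\<^sup>2)" if "\<zeta> \<in> ball 0 1" "\<zeta> \<noteq> 0" for \<zeta>
  proof -
    have "hinner (h (\<zeta> *s u)) ((\<zeta> *s u) /\<^sub>R (norm (\<zeta> *s u))\<^sup>2) = cnj \<zeta> * k \<zeta> / of_real ((cmod \<zeta>)\<^sup>2)"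
      using u by (simp add: hinner_scaleR_right hinner_smult_right norm_smult k_def inverse_eq_divide)
    also have "\<dots> = cnj \<zeta> * (\<zeta> * v \<zeta>) / (\<zeta> * cnj \<zeta>)"
      using that v(2)[of \<zeta>] by (simp add: complex_norm_square del: of_real_power)
    finally show ?thesis
      using that by simp
  qed
  have nz: "complex_of_real (1 - \<alpha>) \<noteq> 0"
    using \<alpha> unfolding of_real_eq_0_iff by simp
  then have L1: "L 1 = 1"
    unfolding L_def add_divide_distrib[symmetric] mult_1_right by simp
  \<comment> \<open>The class condition says nothing at the origin; there the value is
    \<open>L 1 = 1\<close>, which is \<open>g 0\<close>.\<close>
  have g0: "1 \<in> g ` ball 0 1"
    using g[of 0] by (intro image_eqI[of _ _ 0]) auto
  have "cmod (1 - L (v (of_real (norm z))))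
      \<le> cmod (of_real (norm z)) * cmod (of_real B * L (v (of_real (norm z))) - of_real A)"
  proof (rule Schwarz_Pick_moebius[OF g AB])
    show "(\<lambda>\<zeta>. L (v \<zeta>)) holomorphic_on ball 0 1"
      unfolding L_def using nz by (intro holomorphic_intros v(1)) auto
    show "L (v \<zeta>) \<in> g ` ball 0 1" if "\<zeta> \<in> ball 0 1" for \<zeta>
    proof (cases "\<zeta> = 0")
      case True
      then show ?thesis
        using g0 by (simp add: v0 L1)
    next
      case False
      then have "\<zeta> *s u \<noteq> 0"
        using u by (metis norm_smult mult_eq_0_iff norm_eq_zero zero_neq_one)
      then show ?thesis
        using img[of "\<zeta> *s u"] ball[OF that] v_eq[OF that False] by simp
    qed
  qed (use z in \<open>auto simp: v0 L1\<close>)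
  moreover have "v (of_real (norm z)) = p"
    using v_eq[of "of_real (norm z)"] z
    by (simp add: p zu[symmetric] hinner_scaleR_right inverse_eq_divide)
  ultimately show ?thesis
    by (simp add: w L_def)
qed

subsection \<open>First- and second-order conditions at extrema on a sphere\<close>

lemma matrix_vector_mult_scaleR_complex:
  fixes M :: "complex^'n^'m"
  shows "M *v (r *\<^sub>R v) = r *\<^sub>R (M *v v)"
  by (simp only: scaleR_eq_smult vector_scalar_commute)

lemma has_vector_derivative_compose_matrix:
  assumes "(\<gamma> has_vector_derivative v) (at t)" "(f has_derivative (\<lambda>v. M *v v)) (at (\<gamma> t))"
  shows "((\<lambda>t. f (\<gamma> t) :: complex^'n) has_vector_derivative M *v v) (at t)"
  using has_derivative_compose[OF assms(1)[unfolded has_vector_derivative_def] assms(2)]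
  by (simp add: has_vector_derivative_def matrix_vector_mult_scaleR_complex)

lemma has_vector_derivative_quotient_tendsto:
  assumes "(F has_vector_derivative F') (at 0)"
  shows "((\<lambda>e. (F e - F 0) /\<^sub>R e) \<longlongrightarrow> F') (at 0)"
proof -
  have "((\<lambda>e. norm (F e - F 0 - e *\<^sub>R F') / norm e) \<longlongrightarrow> 0) (at 0)"
    using assms by (simp add: has_vector_derivative_def has_derivative_iff_norm)
  moreover have "norm (F e - F 0 - e *\<^sub>R F') / norm e = norm ((F e - F 0) /\<^sub>R e - F')" if "e \<noteq> 0" for e
  proof -
    have "(F e - F 0) /\<^sub>R e - F' = inverse e *\<^sub>R (F e - F 0 - e *\<^sub>R F')"
      using that by (simp add: scaleR_right_diff_distrib)
    then show ?thesis
      by (simp add: divide_inverse mult.commute)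
  qed
  ultimately have "((\<lambda>e. norm ((F e - F 0) /\<^sub>R e - F')) \<longlongrightarrow> 0) (at 0)"
    by (auto elim!: Lim_transform_eventually simp: eventually_at_filter)
  then show ?thesis
    by (simp add: LIM_zero_iff tendsto_norm_zero_iff)
qed

text \<open>Maxima and minima are treated together because the first-order conditions do not
  distinguish them.\<close>

definition sphere_extremum :: "(complex^'n \<Rightarrow> complex^'n) \<Rightarrow> complex^'n \<Rightarrow> bool" where
  "sphere_extremum f z \<longleftrightarrow> (\<forall>\<xi>\<in>sphere 0 (norm z). norm (f \<xi>) \<le> norm (f z)) \<or>
     (\<forall>\<xi>\<in>sphere 0 (norm z). norm (f z) \<le> norm (f \<xi>))"

text \<open>The squared norm of \<open>f\<close> is differentiated along a great circle of the
  sphere that leaves \<open>z\<close> in the direction of \<open>v\<close>; an extremum makes this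
  derivative vanish.\<close>

lemma sphere_extremum_first_order:
  assumes ext: "sphere_extremum f z" and z: "z \<noteq> 0"
    and f: "(f has_derivative (\<lambda>v. M *v v)) (at z)" and v: "v \<bullet> z = 0"
  shows "(M *v v) \<bullet> f z = 0"
proof (cases "v = 0")
  case False
  \<comment> \<open>Rescaling the direction to the length of \<open>z\<close> keeps the curve
    \<open>\<gamma>\<close> on the sphere.\<close>
  define w where "w = (norm z / norm v) *\<^sub>R v"
  have w: "norm w = norm z" "w \<bullet> z = 0"
    using False v by (simp_all add: w_def)
  define \<gamma> where "\<gamma> = (\<lambda>t. cos t *\<^sub>R z + sin t *\<^sub>R w)"
  have "(\<gamma> has_vector_derivative w) (at 0)"
    unfolding \<gamma>_def by (auto intro!: derivative_eq_intros)
  then have "((\<lambda>t. f (\<gamma> t)) has_vector_derivative M *v w) (at 0)"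
    by (rule has_vector_derivative_compose_matrix) (use f in \<open>simp add: \<gamma>_def\<close>)
  then have d: "((\<lambda>t. f (\<gamma> t) \<bullet> f (\<gamma> t)) has_real_derivative 2 * ((M *v w) \<bullet> f z)) (at 0)"
    unfolding has_vector_derivative_def has_field_derivative_def
    by (auto intro!: derivative_eq_intros simp: \<gamma>_def inner_commute algebra_simps)
  have sph: "\<gamma> t \<in> sphere 0 (norm z)" for t
  proof -
    have "(norm (\<gamma> t))\<^sup>2 = (norm (cos t *\<^sub>R z))\<^sup>2 + (norm (sin t *\<^sub>R w))\<^sup>2"
      unfolding \<gamma>_def using w(2) by (intro norm_add_Pythagorean) (simp add: orthogonal_def inner_commute)
    also have "\<dots> = ((cos t)\<^sup>2 + (sin t)\<^sup>2) * (norm z)\<^sup>2"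
      by (simp only: norm_scaleR w(1) power_mult_distrib power2_abs distrib_right)
    finally show ?thesis
      by simp
  qed
  have "f (\<gamma> 0) \<bullet> f (\<gamma> 0) = (norm (f z))\<^sup>2"
    by (simp add: \<gamma>_def power2_norm_eq_inner)
  moreover have "f (\<gamma> t) \<bullet> f (\<gamma> t) = (norm (f (\<gamma> t)))\<^sup>2" for t
    by (simp add: power2_norm_eq_inner)
  ultimately have "(\<forall>t. f (\<gamma> t) \<bullet> f (\<gamma> t) \<le> f (\<gamma> 0) \<bullet> f (\<gamma> 0)) \<or> (\<forall>t. f (\<gamma> 0) \<bullet> f (\<gamma> 0) \<le> f (\<gamma> t) \<bullet> f (\<gamma> t))"
    using ext sph by (auto simp: sphere_extremum_def)
  then have "2 * ((M *v w) \<bullet> f z) = 0"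
    using DERIV_local_max[OF d zero_less_one] DERIV_local_min[OF d zero_less_one] by blast
  then show ?thesis
    using False z by (simp add: w_def matrix_vector_mult_scaleR_complex)
qed simp

text \<open>The Hermitian complement of \<open>z\<close> is a complex subspace, so the real
  condition holds for \<open>v\<close> and for \<open>\<i> *s v\<close>, which handles real and
  imaginary parts.\<close>

lemma sphere_extremum_perp:
  assumes "sphere_extremum f z" "z \<noteq> 0" "(f has_derivative (\<lambda>v. M *v v)) (at z)" "hinner v z = 0"
  shows "hinner (M *v v) (f z) = 0"
proof -
  have "Re (hinner (M *v (c *s v)) (f z)) = 0" for c
    using sphere_extremum_first_order[OF assms(1-3), of "c *s v"] assms(4)
    by (simp add: hinner_smult_left flip: Re_hinner)
  from this[of 1] this[of "\<i>"] show ?thesis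
    unfolding vector_scalar_commute hinner_smult_left by (simp add: complex_eq_iff)
qed

text \<open>The direction \<open>\<i> *s z\<close> is tangent to the sphere in the real sense, and
  the first-order condition for it kills the imaginary part.\<close>

lemma sphere_extremum_real:
  assumes "sphere_extremum f z" "z \<noteq> 0" "(f has_derivative (\<lambda>v. M *v v)) (at z)"
  shows "hinner (M *v z) (f z) \<in> \<real>"
proof -
  have "Re (hinner (M *v (\<i> *s z)) (f z)) = 0"
    using sphere_extremum_first_order[OF assms, of "\<i> *s z"]
    by (simp add: hinner_smult_left hinner_self flip: Re_hinner)
  then show ?thesis
    by (simp add: vector_scalar_commute hinner_smult_left complex_is_Real_iff)
qed

text \<open>In the splitting of \<open>h\<close> into a multiple of \<open>z\<close> and a part
  orthogonal to \<open>z\<close>, the orthogonal part contributes nothing by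
  \<open>sphere_extremum_perp\<close>. Hence the quotient \<open>p\<close> and the radial derivative
  of \<open>f\<close> determine each other.\<close>

lemma sphere_extremum_quotient:
  assumes "sphere_extremum f z" "z \<noteq> 0" "(f has_derivative (\<lambda>v. M *v v)) (at z)" "M *v h = f z"
  shows "hinner h z / of_real ((norm z)\<^sup>2) * hinner (M *v z) (f z) = of_real ((norm (f z))\<^sup>2)"
proof -
  define t where "t = hinner h z / of_real ((norm z)\<^sup>2)"
  have "hinner (h - t *s z) z = 0"
    using assms(2) by (simp add: hinner_diff_left hinner_smult_left hinner_self t_def)
  from sphere_extremum_perp[OF assms(1-3) this]
  have "hinner (M *v h) (f z) = t * hinner (M *v z) (f z)"
    by (simp add: matrix_vector_mult_diff_distrib vector_scalar_commute hinner_diff_left hinner_smult_left)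
  then show ?thesis
    by (simp add: assms(4) hinner_self t_def)
qed

text \<open>The terms of order 1 and 2 of the Taylor expansion cancel over the fourth roots of unity.\<close>

lemma four_point_mean:
  fixes \<phi> :: "complex \<Rightarrow> complex"
  assumes hol: "\<phi> holomorphic_on ball 0 R" and K: "\<And>\<zeta>. \<zeta> \<in> ball 0 R \<Longrightarrow> cmod (\<phi> \<zeta>) \<le> K"
    and \<zeta>: "cmod \<zeta> < R / 2"
  shows "cmod ((\<Sum>k<4. \<phi> (\<i> ^ k * \<zeta>)) - 4 * \<phi> 0) \<le> 768 * K / R ^ 3 * cmod \<zeta> ^ 3"
proof -
  have R: "R > 0"
    using \<zeta> norm_ge_zero[of \<zeta>] by linarith
  define a where "a = (\<lambda>i. (deriv ^^ i) \<phi> 0)"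
  \<comment> \<open>Cauchy's inequality on circles of radius \<open>R / 4\<close>, which stay inside
    \<open>ball 0 R\<close>: the constant is \<open>fact 3 * 4 ^ 3 = 384\<close>.\<close>
  have B: "cmod ((deriv ^^ 3) \<phi> w) \<le> 384 * K / R ^ 3" if "w \<in> ball 0 (R / 2)" for w
  proof -
    have sub: "cball w (R / 4) \<subseteq> ball 0 R"
    proof
      fix x assume "x \<in> cball w (R / 4)"
      then show "x \<in> ball 0 R"
        using that R norm_triangle_ineq2[of x w] by (simp add: dist_norm norm_minus_commute)
    qed
    have "cmod ((deriv ^^ 3) \<phi> w) \<le> fact 3 * K / (R / 4) ^ 3"
    proof (rule Cauchy_inequality)
      show "\<phi> holomorphic_on ball w (R / 4)"
        using hol sub ball_subset_cball by (blast intro: holomorphic_on_subset)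
      show "continuous_on (cball w (R / 4)) \<phi>"
        using hol sub by (blast intro: holomorphic_on_imp_continuous_on holomorphic_on_subset)
      show "cmod (\<phi> x) \<le> K" if "cmod (w - x) = R / 4" for x
        using that sub by (intro K) (auto simp: dist_norm)
    qed (use R in auto)
    then show ?thesis
      by (simp add: power_divide fact_numeral)
  qed
  \<comment> \<open>The remainder bound in use divides by \<open>fact 2\<close>, which gives 192;
    summing four remainders gives 768.\<close>
  have taylor: "cmod (\<phi> x - (a 0 + a 1 * x + a 2 * x\<^sup>2 / 2)) \<le> 192 * K / R ^ 3 * cmod x ^ 3"
    if "x \<in> ball 0 (R / 2)" for x
  proof -
    have "cmod ((deriv ^^ 0) \<phi> x - (\<Sum>i\<le>2. (deriv ^^ i) \<phi> 0 * (x - 0) ^ i / fact i))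
        \<le> 384 * K / R ^ 3 * cmod (x - 0) ^ Suc 2 / fact 2"
    proof (rule complex_Taylor[of "ball 0 (R / 2)"])
      fix i :: nat and y :: complex assume y: "y \<in> ball 0 (R / 2)"
      have "(deriv ^^ i) \<phi> holomorphic_on ball 0 R"
        by (simp add: hol holomorphic_higher_deriv)
      then have "((deriv ^^ i) \<phi> has_field_derivative deriv ((deriv ^^ i) \<phi>) y) (at y)"
        by (rule holomorphic_derivI) (use y R in auto)
      then show "((deriv ^^ i) \<phi> has_field_derivative (deriv ^^ Suc i) \<phi> y) (at y within ball 0 (R / 2))"
        by (simp add: has_field_derivative_at_within)
    next
      show "cmod ((deriv ^^ Suc 2) \<phi> y) \<le> 384 * K / R ^ 3" if "y \<in> ball 0 (R / 2)" for y
        using B[OF that] by (simp add: eval_nat_numeral)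
    qed (use that R in auto)
    then show ?thesis
      by (simp add: a_def eval_nat_numeral algebra_simps)
  qed
  define T where "T = (\<lambda>x. \<phi> x - (a 0 + a 1 * x + a 2 * x\<^sup>2 / 2))"
  have "(\<Sum>k<4. \<phi> (\<i> ^ k * \<zeta>)) - 4 * \<phi> 0 = (\<Sum>k<4. T (\<i> ^ k * \<zeta>))"
    by (simp add: T_def a_def eval_nat_numeral algebra_simps)
  also have "cmod \<dots> \<le> (\<Sum>k<(4::nat). 192 * K / R ^ 3 * cmod \<zeta> ^ 3)"
  proof (rule sum_norm_le)
    fix k :: nat
    have "cmod (\<i> ^ k * \<zeta>) = cmod \<zeta>"
      by (simp add: norm_mult norm_power)
    then show "cmod (T (\<i> ^ k * \<zeta>)) \<le> 192 * K / R ^ 3 * cmod \<zeta> ^ 3"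
      using taylor[of "\<i> ^ k * \<zeta>"] \<zeta> unfolding T_def by simp
  qed
  finally show ?thesis
    by simp
qed

text \<open>For \<open>x\<close> a value of \<open>f\<close> and \<open>u\<close> fixed, the
  increment of the squared norm splits into a square, whose limit needs only the first derivative,
  and the real part of a function holomorphic in the argument of \<open>f\<close>, to which the
  four-point mean applies.\<close>

lemma norm_diff_expand:
  fixes x u :: "complex^'n"
  shows "(norm x)\<^sup>2 - (norm u)\<^sup>2 = (norm (x - u))\<^sup>2 + 2 * Re (hinner x u - hinner u u)"
  by (simp add: Re_hinner power2_norm_eq_inner inner_diff_left inner_diff_right inner_commute)

lemma holomorphic_ball_continuous_on:
  assumes "holomorphic_ball f"
  shows "continuous_on (ball 0 1) f"
  using assms unfolding holomorphic_ball_def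
  by (metis continuous_at_imp_continuous_on has_derivative_continuous)

text \<open>The four points \<open>sqrt (1 - e\<^sup>2) z + \<i>\<^sup>k e \<delta>\<close> lie on the sphere of radius \<open>norm z\<close> if \<open>\<delta>\<close> is
  orthogonal to \<open>z\<close> and of the same norm; for fixed \<open>e\<close> they lie on an affine complex line, where
  the mean value property eliminates the second derivative of \<open>f\<close>.\<close>

lemma second_order_limit:
  fixes f :: "complex^'n \<Rightarrow> complex^'n" and z \<delta> :: "complex^'n"
  assumes holo: "holomorphic_ball f" and z: "z \<in> ball 0 1 - {0}"
    and f: "(f has_derivative (\<lambda>v. M *v v)) (at z)" and \<delta>: "norm \<delta> = norm z"
  shows "((\<lambda>e. (\<Sum>k<4. (norm (f (sqrt (1 - e\<^sup>2) *\<^sub>R z + (\<i> ^ k * of_real e) *s \<delta>)))\<^sup>2 - (norm (f z))\<^sup>2) / e\<^sup>2)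
    \<longlongrightarrow> 4 * ((norm (M *v \<delta>))\<^sup>2 - Re (hinner (M *v z) (f z)))) (at 0)"
proof -
  define u where "u = f z"
  define \<Phi> where "\<Phi> = (\<lambda>x. hinner (f x) u)"
  define x where "x = (\<lambda>(k::nat) e. sqrt (1 - e\<^sup>2) *\<^sub>R z + (\<i> ^ k * of_real e) *s \<delta>)"
  define c where "c = (\<lambda>e::real. sqrt (1 - e\<^sup>2) *\<^sub>R z)"

  \<comment> \<open>Since \<open>sqrt (1 - e^2)\<close> has derivative 0 at 0, the point
    \<open>x k e\<close> starts with velocity \<open>\<i> ^ k *s \<delta>\<close>, and the factor
    \<open>\<i> ^ k\<close> disappears in the norm.\<close>
  have lim_sq: "((\<lambda>e. (norm (f (x k e) - u))\<^sup>2 / e\<^sup>2) \<longlongrightarrow> (norm (M *v \<delta>))\<^sup>2) (at 0)" for k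
  proof -
    have "(x k has_vector_derivative (\<i> ^ k) *s \<delta>) (at 0)"
    proof -
      have "((\<lambda>e. sqrt (1 - e\<^sup>2)) has_real_derivative 0) (at 0)"
        by (auto intro!: derivative_eq_intros)
      then have "((\<lambda>e. sqrt (1 - e\<^sup>2) *\<^sub>R z + e *\<^sub>R (\<i> ^ k *s \<delta>)) has_vector_derivative (\<i> ^ k) *s \<delta>) (at 0)"
        by (auto intro!: derivative_eq_intros)
      moreover have "x k = (\<lambda>e. sqrt (1 - e\<^sup>2) *\<^sub>R z + e *\<^sub>R (\<i> ^ k *s \<delta>))"
        by (simp add: x_def scaleR_eq_smult mult.commute)
      ultimately show ?thesis
        by simp
    qed
    then have "((\<lambda>e. f (x k e)) has_vector_derivative M *v (\<i> ^ k *s \<delta>)) (at 0)"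
      by (rule has_vector_derivative_compose_matrix) (use f in \<open>simp add: x_def\<close>)
    from tendsto_power[OF tendsto_norm[OF has_vector_derivative_quotient_tendsto[OF this]], of 2]
    show ?thesis
      by (simp add: x_def u_def vector_scalar_commute norm_smult norm_mult norm_power power_mult_distrib
          power_inverse divide_inverse mult.commute)
  qed

  \<comment> \<open>The shift of the centre is of second order in \<open>e\<close>. In the variable
    \<open>s = e^2\<close> it is of first order, so the first derivative of \<open>f\<close>
    suffices.\<close>
  have lim_c: "((\<lambda>e. (\<Phi> (c e) - \<Phi> z) /\<^sub>R e\<^sup>2) \<longlongrightarrow> - hinner (M *v z) u / 2) (at 0)"
  proof -
    have "((\<lambda>s. sqrt (1 - s)) has_real_derivative - (1 / 2)) (at 0)"
      by (auto intro!: derivative_eq_intros)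
    then have "((\<lambda>s. sqrt (1 - s) *\<^sub>R z) has_vector_derivative - (1 / 2) *\<^sub>R z) (at 0)"
      by (auto intro!: derivative_eq_intros)
    then have "((\<lambda>s. f (sqrt (1 - s) *\<^sub>R z)) has_vector_derivative M *v (- (1 / 2) *\<^sub>R z)) (at 0)"
      by (rule has_vector_derivative_compose_matrix) (use f in simp)
    from bounded_linear.has_vector_derivative[OF bounded_linear_hinner_left this, of u]
    have "((\<lambda>s. \<Phi> (sqrt (1 - s) *\<^sub>R z)) has_vector_derivative - hinner (M *v z) u / 2) (at 0)"
      unfolding matrix_vector_mult_scaleR_complex hinner_scaleR_left by (simp add: \<Phi>_def)
    from has_vector_derivative_quotient_tendsto[OF this]
    have "((\<lambda>s. (\<Phi> (sqrt (1 - s) *\<^sub>R z) - \<Phi> z) /\<^sub>R s) \<longlongrightarrow> - hinner (M *v z) u / 2) (at 0)"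
      by simp
    moreover have "filterlim (\<lambda>e::real. e\<^sup>2) (at 0) (at 0)"
      unfolding filterlim_at by (auto intro!: tendsto_eq_intros simp: eventually_at_filter)
    ultimately show ?thesis
      unfolding c_def by (rule filterlim_compose)
  qed

  have lim_mean: "((\<lambda>e. ((\<Sum>k<4. \<Phi> (x k e)) - 4 * \<Phi> (c e)) /\<^sub>R e\<^sup>2) \<longlongrightarrow> 0) (at 0)"
  proof -
    \<comment> \<open>The ball of radius \<open>s\<close> reaches half way from
      \<open>norm z\<close> to the unit sphere. Since
      \<open>norm (c e) \<le> norm z = norm \<delta>\<close>, discs of radius \<open>R\<close> in
      the line parameter stay inside it, which gives a bound \<open>K\<close> independent of
      \<open>e\<close>.\<close>
    define s where "s = (1 + norm z) / 2"
    define R where "R = (1 - norm z) / (2 * norm z)"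
    have s: "s < 1" and R: "R > 0" "norm z + R * norm z = s"
      using z by (simp_all add: s_def R_def field_simps)
    have sub: "cball 0 s \<subseteq> ball (0 :: complex^'n) 1"
      using s by auto
    have "continuous_on (cball 0 s) \<Phi>"
      unfolding \<Phi>_def
      by (intro bounded_linear.continuous_on[OF bounded_linear_hinner_left]
          continuous_on_subset[OF holomorphic_ball_continuous_on[OF holo] sub])
    then have "bounded (\<Phi> ` cball 0 s)"
      by (intro compact_imp_bounded compact_continuous_image compact_cball)
    then obtain K where K: "\<And>y. y \<in> cball 0 s \<Longrightarrow> cmod (\<Phi> y) \<le> K"
      unfolding bounded_iff by blast
    have bound: "norm (((\<Sum>k<4. \<Phi> (x k e)) - 4 * \<Phi> (c e)) /\<^sub>R e\<^sup>2) \<le> 768 * K / R ^ 3 * \<bar>e\<bar>"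
      if e: "\<bar>e\<bar> < min 1 (R / 2)" "e \<noteq> 0" for e
    proof -
      define \<phi> where "\<phi> = (\<lambda>\<zeta>. \<Phi> (c e + \<zeta> *s \<delta>))"
      have e2: "e\<^sup>2 \<le> 1"
        using e(1) by (simp add: abs_square_le_1)
      then have "sqrt (1 - e\<^sup>2) \<le> 1"
        by simp
      then have ce: "norm (c e) \<le> norm z"
        using e2 mult_right_mono[of "sqrt (1 - e\<^sup>2)" 1 "norm z"] by (simp add: c_def)
      have in_s: "c e + \<zeta> *s \<delta> \<in> cball 0 s" if "\<zeta> \<in> ball 0 R" for \<zeta>
      proof -
        have "norm (c e + \<zeta> *s \<delta>) \<le> norm (c e) + cmod \<zeta> * norm z"
          using norm_triangle_ineq[of "c e" "\<zeta> *s \<delta>"] by (simp add: norm_smult \<delta>)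
        also have "\<dots> \<le> norm z + R * norm z"
          using that ce by (intro add_mono mult_right_mono) auto
        finally show ?thesis
          using R(2) by simp
      qed
      have "\<phi> holomorphic_on ball 0 R"
      proof -
        have "\<exists>D. (\<phi> has_field_derivative D) (at \<zeta>)" if \<zeta>: "\<zeta> \<in> ball 0 R" for \<zeta>
        proof -
          obtain N where "(f has_derivative (\<lambda>v. N *v v)) (at (c e + \<zeta> *s \<delta>))"
            using holo in_s[OF \<zeta>] sub unfolding holomorphic_ball_def by blast
          from has_field_derivative_hinner_slice[OF this] show ?thesis
            unfolding \<phi>_def \<Phi>_def by blast
        qed
        then show ?thesis
          by (metis holomorphic_on_open open_ball)
      qed
      then have "cmod ((\<Sum>k<4. \<phi> (\<i> ^ k * of_real e)) - 4 * \<phi> 0) \<le> 768 * K / R ^ 3 * cmod (of_real e) ^ 3"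
        by (rule four_point_mean) (use K in_s e(1) in \<open>auto simp: \<phi>_def\<close>)
      then have "cmod ((\<Sum>k<4. \<Phi> (x k e)) - 4 * \<Phi> (c e)) \<le> 768 * K / R ^ 3 * \<bar>e\<bar> * e\<^sup>2"
        by (simp add: \<phi>_def x_def c_def power3_eq_cube power2_eq_square mult.assoc)
      then show ?thesis
        using e(2) unfolding norm_scaleR abs_inverse inverse_eq_divide by (simp add: pos_divide_le_eq)
    qed
    show ?thesis
    proof (rule Lim_null_comparison)
      show "((\<lambda>e. 768 * K / R ^ 3 * \<bar>e\<bar>) \<longlongrightarrow> 0) (at (0::real))"
        using R(1) by (auto intro!: tendsto_eq_intros)
      have "\<forall>\<^sub>F e in at 0. \<bar>e\<bar> < min 1 (R / 2) \<and> e \<noteq> (0::real)"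
        unfolding eventually_at using R(1) by (intro exI[of _ "min 1 (R / 2)"]) (auto simp: dist_real_def)
      then show "\<forall>\<^sub>F e in at 0. norm (((\<Sum>k<4. \<Phi> (x k e)) - 4 * \<Phi> (c e)) /\<^sub>R e\<^sup>2) \<le> 768 * K / R ^ 3 * \<bar>e\<bar>"
        by eventually_elim (use bound in blast)
    qed
  qed

  \<comment> \<open>The cross term is compared with \<open>\<Phi> z\<close> in two stages, through
    the moving centre \<open>c e\<close>: from the four points to the centre, and from the centre to
    \<open>z\<close>.\<close>
  have "((\<lambda>e. (\<Sum>k<4. (norm (f (x k e) - u))\<^sup>2 / e\<^sup>2)
        + 2 * Re (((\<Sum>k<4. \<Phi> (x k e)) - 4 * \<Phi> (c e)) /\<^sub>R e\<^sup>2 + 4 * ((\<Phi> (c e) - \<Phi> z) /\<^sub>R e\<^sup>2)))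
      \<longlongrightarrow> (\<Sum>k<(4::nat). (norm (M *v \<delta>))\<^sup>2) + 2 * Re (0 + 4 * (- hinner (M *v z) u / 2))) (at 0)"
    by (intro tendsto_intros lim_sq lim_c lim_mean)
  moreover have "(\<Sum>k<4. (norm (f (x k e) - u))\<^sup>2 / e\<^sup>2)
        + 2 * Re (((\<Sum>k<4. \<Phi> (x k e)) - 4 * \<Phi> (c e)) /\<^sub>R e\<^sup>2 + 4 * ((\<Phi> (c e) - \<Phi> z) /\<^sub>R e\<^sup>2))
      = (\<Sum>k<4. (norm (f (x k e)))\<^sup>2 - (norm u)\<^sup>2) / e\<^sup>2" for e
  proof -
    have "(\<Sum>k<4. (norm (f (x k e)))\<^sup>2 - (norm u)\<^sup>2)
        = (\<Sum>k<4. (norm (f (x k e) - u))\<^sup>2) + 2 * Re ((\<Sum>k<4. \<Phi> (x k e)) - 4 * \<Phi> z)"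
      unfolding norm_diff_expand[of "f _"] sum.distrib
      by (simp add: \<Phi>_def u_def sum_subtractf flip: sum_distrib_left)
    moreover have "Re (((\<Sum>k<4. \<Phi> (x k e)) - 4 * \<Phi> (c e)) /\<^sub>R e\<^sup>2 + 4 * ((\<Phi> (c e) - \<Phi> z) /\<^sub>R e\<^sup>2))
        = Re ((\<Sum>k<4. \<Phi> (x k e)) - 4 * \<Phi> z) / e\<^sup>2"
      by (simp add: divide_inverse algebra_simps)
    ultimately show ?thesis
      by (simp only: sum_divide_distrib[symmetric] add_divide_distrib times_divide_eq_right)
  qed
  moreover have "(\<Sum>k<(4::nat). (norm (M *v \<delta>))\<^sup>2) + 2 * Re (0 + 4 * (- hinner (M *v z) u / 2))
      = 4 * ((norm (M *v \<delta>))\<^sup>2 - Re (hinner (M *v z) u))"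
    by simp
  ultimately show ?thesis
    by (simp only: x_def u_def)
qed

lemma four_points_on_sphere:
  fixes z \<delta> :: "complex^'n"
  assumes "norm \<delta> = norm z" "hinner \<delta> z = 0" "\<bar>e\<bar> \<le> 1"
  shows "sqrt (1 - e\<^sup>2) *\<^sub>R z + (\<i> ^ k * of_real e) *s \<delta> \<in> sphere 0 (norm z)"
proof -
  have "hinner z \<delta> = 0"
    using cnj_hinner[of \<delta> z] assms(2) by simp
  then have "hinner (sqrt (1 - e\<^sup>2) *\<^sub>R z) ((\<i> ^ k * of_real e) *s \<delta>) = 0"
    by (simp add: hinner_scaleR_left hinner_smult_right)
  moreover have "e\<^sup>2 \<le> 1"
    using assms(3) by (simp add: abs_square_le_1)
  ultimately have "(norm (sqrt (1 - e\<^sup>2) *\<^sub>R z + (\<i> ^ k * of_real e) *s \<delta>))\<^sup>2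
      = (1 - e\<^sup>2) * (norm z)\<^sup>2 + e\<^sup>2 * (norm z)\<^sup>2"
    by (subst Pythagoras_hinner) (simp_all add: norm_smult norm_mult norm_power assms(1) power_mult_distrib)
  also have "\<dots> = (norm z)\<^sup>2"
    by (simp add: algebra_simps)
  finally have "(norm (sqrt (1 - e\<^sup>2) *\<^sub>R z + (\<i> ^ k * of_real e) *s \<delta>))\<^sup>2 = (norm z)\<^sup>2" .
  then show ?thesis
    by simp
qed

text \<open>After rescaling \<open>v\<close> to the length of \<open>z\<close>, all four points lie
  on the sphere, so each summand in \<open>second_order_limit\<close> is at most 0, and so is the
  limit.\<close>

lemma sphere_max_tangent_le:
  fixes f :: "complex^'n \<Rightarrow> complex^'n"
  assumes holo: "holomorphic_ball f" and z: "z \<in> ball 0 1 - {0}"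
    and f: "(f has_derivative (\<lambda>v. M *v v)) (at z)"
    and max: "\<And>\<xi>. \<xi> \<in> sphere 0 (norm z) \<Longrightarrow> norm (f \<xi>) \<le> norm (f z)"
    and v: "hinner v z = 0"
  shows "(norm (M *v v))\<^sup>2 * (norm z)\<^sup>2 \<le> Re (hinner (M *v z) (f z)) * (norm v)\<^sup>2"
proof (cases "v = 0")
  case False
  define c where "c = norm z / norm v"
  define \<delta> where "\<delta> = c *\<^sub>R v"
  have \<delta>: "norm \<delta> = norm z" "hinner \<delta> z = 0"
    using False v by (simp_all add: \<delta>_def c_def hinner_scaleR_left)
  have "\<forall>\<^sub>F e in at 0. \<bar>e\<bar> \<le> (1::real)"
    unfolding eventually_at by (intro exI[of _ 1]) (auto simp: dist_real_def)
  then have "\<forall>\<^sub>F e in at 0. (\<Sum>k<4. (norm (f (sqrt (1 - e\<^sup>2) *\<^sub>R z + (\<i> ^ k * of_real e) *s \<delta>)))\<^sup>2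
      - (norm (f z))\<^sup>2) / e\<^sup>2 \<le> 0"
  proof eventually_elim
    case (elim e)
    show ?case
      using max[OF four_points_on_sphere[OF \<delta> elim]]
      by (intro divide_nonpos_nonneg sum_nonpos) (auto intro: power_mono)
  qed
  then have "4 * ((norm (M *v \<delta>))\<^sup>2 - Re (hinner (M *v z) (f z))) \<le> 0"
    by (intro tendsto_upperbound[OF second_order_limit[OF holo z f \<delta>(1)]]) auto
  then have "(c * norm (M *v v))\<^sup>2 \<le> Re (hinner (M *v z) (f z))"
    by (simp add: \<delta>_def matrix_vector_mult_scaleR_complex power_mult_distrib)
  then show ?thesis
    using False by (simp add: c_def power_mult_distrib power_divide pos_divide_le_eq mult.commute)
qed simp

text \<open>At a minimum the four summands are nonnegative, which reverses the conclusion.\<close>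

lemma sphere_min_tangent_ge:
  fixes f :: "complex^'n \<Rightarrow> complex^'n"
  assumes holo: "holomorphic_ball f" and z: "z \<in> ball 0 1 - {0}"
    and f: "(f has_derivative (\<lambda>v. M *v v)) (at z)"
    and min: "\<And>\<xi>. \<xi> \<in> sphere 0 (norm z) \<Longrightarrow> norm (f z) \<le> norm (f \<xi>)"
    and v: "hinner v z = 0"
  shows "(norm (M *v v))\<^sup>2 * (norm z)\<^sup>2 \<ge> Re (hinner (M *v z) (f z)) * (norm v)\<^sup>2"
proof (cases "v = 0")
  case False
  define c where "c = norm z / norm v"
  define \<delta> where "\<delta> = c *\<^sub>R v"
  have \<delta>: "norm \<delta> = norm z" "hinner \<delta> z = 0"
    using False v by (simp_all add: \<delta>_def c_def hinner_scaleR_left)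
  have "\<forall>\<^sub>F e in at 0. \<bar>e\<bar> \<le> (1::real)"
    unfolding eventually_at by (intro exI[of _ 1]) (auto simp: dist_real_def)
  then have "\<forall>\<^sub>F e in at 0. 0 \<le> (\<Sum>k<4. (norm (f (sqrt (1 - e\<^sup>2) *\<^sub>R z + (\<i> ^ k * of_real e) *s \<delta>)))\<^sup>2
      - (norm (f z))\<^sup>2) / e\<^sup>2"
  proof eventually_elim
    case (elim e)
    show ?case
      using min[OF four_points_on_sphere[OF \<delta> elim]]
      by (intro divide_nonneg_nonneg sum_nonneg) (auto intro: power_mono)
  qed
  then have "0 \<le> 4 * ((norm (M *v \<delta>))\<^sup>2 - Re (hinner (M *v z) (f z)))"
    by (intro tendsto_lowerbound[OF second_order_limit[OF holo z f \<delta>(1)]]) auto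
  then have "Re (hinner (M *v z) (f z)) \<le> (c * norm (M *v v))\<^sup>2"
    by (simp add: \<delta>_def matrix_vector_mult_scaleR_complex power_mult_distrib)
  then show ?thesis
    using False by (simp add: c_def power_mult_distrib power_divide pos_le_divide_eq mult.commute)
qed simp

subsection \<open>Growth\<close>

text \<open>The sign \<open>\<sigma>\<close> handles the upper bound (1) and the lower bound (-1) at
  once; for the latter the comparison function is read at negative arguments. The maximum of
  \<open>H\<close> on an annulus, up to a small radial term, must sit on the inner sphere, because
  \<open>ext\<close> makes the radial derivative negative elsewhere; near the origin
  \<open>H\<close> is small.\<close>

lemma growth_comparison:
  fixes f :: "complex^'n \<Rightarrow> complex^'n" and \<psi> \<psi>' :: "real \<Rightarrow> real" and \<sigma> :: real
  assumes \<sigma>: "\<sigma> = 1 \<or> \<sigma> = -1" and holo: "holomorphic_ball f"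
    and f0: "f 0 = 0" "cjacobian f 0 = mat 1"
    and nz: "\<And>x. x \<in> ball 0 1 - {0} \<Longrightarrow> f x \<noteq> 0"
    and \<psi>: "\<And>t. \<bar>t\<bar> < 1 \<Longrightarrow> (\<psi> has_real_derivative \<psi>' t) (at t)" "\<psi> 0 = 0"
    and ext: "\<And>x. \<lbrakk>x \<in> ball 0 1 - {0}; \<And>\<xi>. \<xi> \<in> sphere 0 (norm x) \<Longrightarrow> \<sigma> * norm (f \<xi>) \<le> \<sigma> * norm (f x)\<rbrakk>
      \<Longrightarrow> \<sigma> * (Re (hinner (cjacobian f x *v x) (f x)) / (norm (f x))\<^sup>2)
          \<le> \<sigma> * (1 + \<sigma> * norm x * \<psi>' (\<sigma> * norm x))"
    and z: "z \<in> ball 0 1 - {0}"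
  shows "\<sigma> * ln (norm (f z) / norm z) \<le> \<sigma> * \<psi> (\<sigma> * norm z)"
proof -
  define H where "H = (\<lambda>x. \<sigma> * (ln (norm (f x)) - ln (norm x) - \<psi> (\<sigma> * norm x)))"
  have der: "(f has_derivative (\<lambda>v. cjacobian f x *v v)) (at x)" if "x \<in> ball 0 1" for x
    using holo that cjacobian_eq unfolding holomorphic_ball_def by blast
  have \<sigma>1: "\<bar>\<sigma> * norm x\<bar> < 1" if "x \<in> ball 0 1" for x :: "complex^'n"
    using \<sigma> that by auto
  \<comment> \<open>The derivative of \<open>f\<close> at 0 is the identity, so
    \<open>norm (f x) / norm x\<close> tends to 1.\<close>
  have conv: "(H \<longlongrightarrow> 0) (at 0)"
  proof -
    have "((\<lambda>x. norm (f x - f 0 - (x - 0)) / norm (x - 0)) \<longlongrightarrow> 0) (at 0)"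
      using der[of 0] by (simp add: f0 has_derivative_iff_norm)
    then have "((\<lambda>x. norm (f x) / norm x - 1) \<longlongrightarrow> 0) (at 0)"
    proof (rule Lim_null_comparison[rotated])
      have "norm (norm (f x) / norm x - 1) \<le> norm (f x - f 0 - (x - 0)) / norm (x - 0)" if "x \<noteq> 0" for x
      proof -
        have "\<bar>norm (f x) / norm x - 1\<bar> = \<bar>norm (f x) - norm x\<bar> / norm x"
          using that by (subst abs_div_pos) (simp_all add: diff_divide_distrib)
        then show ?thesis
          using norm_triangle_ineq3[of "f x" x] by (simp add: f0 divide_right_mono)
      qed
      then show "\<forall>\<^sub>F x in at 0. norm (norm (f x) / norm x - 1) \<le> norm (f x - f 0 - (x - 0)) / norm (x - 0)"
        by (auto simp: eventually_at_filter)
    qed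
    then have "((\<lambda>x. norm (f x) / norm x) \<longlongrightarrow> 1) (at 0)"
      by (simp add: LIM_zero_iff)
    then have ln: "((\<lambda>x. ln (norm (f x) / norm x)) \<longlongrightarrow> 0) (at 0)"
      using tendsto_ln[of _ 1] by fastforce
    have "isCont \<psi> 0"
      using \<psi>(1)[of 0] DERIV_isCont by auto
    moreover have "((\<lambda>x::complex^'n. \<sigma> * norm x) \<longlongrightarrow> 0) (at 0)"
      by (auto intro!: tendsto_eq_intros)
    ultimately have \<psi>_lim: "((\<lambda>x::complex^'n. \<psi> (\<sigma> * norm x)) \<longlongrightarrow> \<psi> 0) (at 0)"
      by (rule isCont_tendsto_compose)
    have "((\<lambda>x. \<sigma> * (ln (norm (f x) / norm x) - \<psi> (\<sigma> * norm x))) \<longlongrightarrow> 0) (at 0)"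
      using tendsto_mult[OF tendsto_const tendsto_diff[OF ln \<psi>_lim], of \<sigma>] \<psi>(2) by simp
    moreover have "\<forall>\<^sub>F x in at 0. \<sigma> * (ln (norm (f x) / norm x) - \<psi> (\<sigma> * norm x)) = H x"
      unfolding eventually_at
      by (intro exI[of _ 1]) (use nz in \<open>auto simp: H_def ln_div\<close>)
    ultimately show ?thesis
      by (rule Lim_transform_eventually)
  qed
  have cont: "continuous_on (ball 0 1 - {0}) H"
  proof -
    have "continuous_on (ball 0 1 - {0}) (\<lambda>x :: complex^'n. \<psi> (\<sigma> * norm x))"
    proof (rule continuous_on_compose2[of "{-1<..<1}" \<psi>])
      have "isCont \<psi> t" if "t \<in> {-1<..<1}" for t
        using \<psi>(1)[of t] that DERIV_isCont by (auto simp: abs_less_iff)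
      then show "continuous_on {-1<..<1} \<psi>"
        by (simp add: continuous_at_imp_continuous_on)
      show "(\<lambda>x :: complex^'n. \<sigma> * norm x) ` (ball 0 1 - {0}) \<subseteq> {-1<..<1}"
      proof (rule image_subsetI)
        fix x :: "complex^'n" assume "x \<in> ball 0 1 - {0}"
        then have "\<bar>\<sigma> * norm x\<bar> < 1"
          by (intro \<sigma>1) simp
        then show "\<sigma> * norm x \<in> {-1<..<1}"
          unfolding greaterThanLessThan_iff by linarith
      qed
    qed (auto intro: continuous_intros)
    moreover have "continuous_on (ball 0 1 - {0}) f"
      using holomorphic_ball_continuous_on[OF holo] by (rule continuous_on_subset) auto
    ultimately show ?thesis
      unfolding H_def using nz by (auto intro!: continuous_intros)
  qed
  \<comment> \<open>Subtracting \<open>\<epsilon> * norm x\<close> turns the weak differential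
    inequality from \<open>ext\<close> into a strict one. The inner radius \<open>s\<close> is so
    small that \<open>H\<close> is below \<open>\<epsilon>\<close> there.\<close>
  have key: "H z \<le> \<epsilon> * norm z + \<epsilon>" if \<epsilon>: "\<epsilon> > 0" for \<epsilon>
  proof -
    obtain d where d: "d > 0" "\<And>x. x \<noteq> 0 \<Longrightarrow> norm x < d \<Longrightarrow> \<bar>H x\<bar> < \<epsilon>"
      using tendstoD[OF conv \<epsilon>] by (auto simp: eventually_at dist_real_def)
    define s where "s = min (d / 2) (norm z)"
    have s: "0 < s" "s \<le> norm z" "s < d"
      using d(1) z by (auto simp: s_def)
    define K where "K = cball 0 (norm z) - ball (0 :: complex^'n) s"
    have K: "K \<subseteq> ball 0 1 - {0}" "z \<in> K"
      using s z by (auto simp: K_def)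
    have "compact K"
      by (simp add: K_def compact_diff)
    then obtain x0 where x0: "x0 \<in> K" "\<And>x. x \<in> K \<Longrightarrow> H x - \<epsilon> * norm x \<le> H x0 - \<epsilon> * norm x0"
      using continuous_attains_sup[of K "\<lambda>x. H x - \<epsilon> * norm x"] K
      by (force intro!: continuous_intros continuous_on_subset[OF cont K(1)])
    have x0': "x0 \<in> ball 0 1 - {0}"
      using x0(1) K(1) by auto
    have "norm x0 = s"
    proof (rule ccontr)
      assume "norm x0 \<noteq> s"
      then have gt: "s < norm x0"
        using x0(1) by (auto simp: K_def)
      \<comment> \<open>On one sphere the radial terms are constant, so maximality of
        \<open>x0\<close> compares only \<open>\<sigma> * ln (norm (f \<xi>))\<close> and yields the
        extremality required by \<open>ext\<close>.\<close>
      have "\<sigma> * norm (f \<xi>) \<le> \<sigma> * norm (f x0)" if \<xi>: "\<xi> \<in> sphere 0 (norm x0)" for \<xi>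
      proof -
        have "\<xi> \<in> K"
          using \<xi> x0(1) by (auto simp: K_def)
        then have "\<sigma> * ln (norm (f \<xi>)) \<le> \<sigma> * ln (norm (f x0))"
          using x0(2)[of \<xi>] \<xi> by (simp add: H_def algebra_simps)
        moreover have "f \<xi> \<noteq> 0" "f x0 \<noteq> 0"
          using nz x0' K(1) \<open>\<xi> \<in> K\<close> by (blast, blast)
        ultimately show ?thesis
          using \<sigma> by auto
      qed
      from ext[OF x0' this]
      have le: "\<sigma> * (Re (hinner (cjacobian f x0 *v x0) (f x0)) / (norm (f x0))\<^sup>2)
          \<le> \<sigma> * (1 + \<sigma> * norm x0 * \<psi>' (\<sigma> * norm x0))" .
      \<comment> \<open>For \<open>t > 0\<close> this is the maximised quantity at
        \<open>t *\<^sub>R x0\<close>; a negative derivative at 1 produces a larger value closer to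
        the origin.\<close>
      define D where "D = (\<lambda>t. \<sigma> * (ln (norm (f (t *\<^sub>R x0))) - ln (t * norm x0) - \<psi> (\<sigma> * (t * norm x0))) - \<epsilon> * (t * norm x0))"
      have vd: "((\<lambda>t. f (t *\<^sub>R x0)) has_vector_derivative cjacobian f x0 *v x0) (at 1)"
        by (rule has_vector_derivative_compose_matrix) (use der[of x0] x0' in \<open>auto intro!: derivative_eq_intros\<close>)
      have "((\<lambda>t. norm (f (t *\<^sub>R x0))) has_real_derivative
          ((cjacobian f x0 *v x0) \<bullet> f x0) / norm (f x0)) (at 1)"
      proof -
        have "(norm has_derivative (\<lambda>h. sgn (f x0) \<bullet> h)) (at (f (1 *\<^sub>R x0)))"
          using has_derivative_norm[of "f x0"] nz[OF x0'] by (simp add: inner_commute)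
        from has_derivative_compose[OF vd[unfolded has_vector_derivative_def] this] show ?thesis
          unfolding has_field_derivative_def
          by (rule has_derivative_eq_rhs) (simp add: fun_eq_iff sgn_div_norm inner_commute divide_inverse)
      qed
      then have d1: "((\<lambda>t. ln (norm (f (t *\<^sub>R x0)))) has_real_derivative
          Re (hinner (cjacobian f x0 *v x0) (f x0)) / (norm (f x0))\<^sup>2) (at 1)"
        using nz[OF x0'] by (auto intro!: derivative_eq_intros simp: Re_hinner power2_eq_square)
      have d2: "((\<lambda>t. \<psi> (\<sigma> * (t * norm x0))) has_real_derivative \<psi>' (\<sigma> * norm x0) * (\<sigma> * norm x0)) (at 1)"
        by (rule DERIV_chain2[where f = \<psi>]) (use \<psi>(1)[OF \<sigma>1] x0' in \<open>auto intro!: derivative_eq_intros\<close>)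
      have d3: "((\<lambda>t. ln (t * norm x0)) has_real_derivative 1) (at 1)"
        using x0' by (auto intro!: derivative_eq_intros)
      have d4: "((\<lambda>t. \<epsilon> * (t * norm x0)) has_real_derivative \<epsilon> * norm x0) (at 1)"
        by (auto intro!: derivative_eq_intros)
      have "(D has_real_derivative \<sigma> * (Re (hinner (cjacobian f x0 *v x0) (f x0)) / (norm (f x0))\<^sup>2
          - 1 - \<psi>' (\<sigma> * norm x0) * (\<sigma> * norm x0)) - \<epsilon> * norm x0) (at 1)"
        using DERIV_diff[OF DERIV_cmult[OF DERIV_diff[OF DERIV_diff[OF d1 d3] d2], of \<sigma>] d4]
        unfolding D_def .
      moreover have "\<epsilon> * norm x0 > 0"
        using \<epsilon> x0' by simp
      with le have "\<sigma> * (Re (hinner (cjacobian f x0 *v x0) (f x0)) / (norm (f x0))\<^sup>2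
          - 1 - \<psi>' (\<sigma> * norm x0) * (\<sigma> * norm x0)) - \<epsilon> * norm x0 < 0"
        by (simp add: algebra_simps)
      ultimately obtain e where e: "e > 0" "\<And>h. 0 < h \<Longrightarrow> h < e \<Longrightarrow> D 1 < D (1 - h)"
        using DERIV_neg_dec_left by blast
      \<comment> \<open>The first bound stays in the range where \<open>D\<close> is larger, the
        second keeps \<open>(1 - h) *\<^sub>R x0\<close> in the annulus.\<close>
      define h where "h = min (e / 2) (1 - s / norm x0)"
      have h: "0 < h" "h < e" "h < 1" "s \<le> (1 - h) * norm x0"
      proof -
        have nx: "0 < norm x0"
          using gt s(1) by linarith
        have "s / norm x0 < 1" "s / norm x0 > 0"
          using gt s(1) divide_pos_pos[OF s(1) nx] by (simp_all only: divide_less_eq_1_pos[OF nx])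
        then show "0 < h" "h < e" "h < 1"
          using e(1) by (auto simp: h_def)
        have "s / norm x0 \<le> 1 - h"
          by (simp add: h_def)
        then show "s \<le> (1 - h) * norm x0"
          using pos_divide_le_eq[OF nx] by blast
      qed
      have "(1 - h) * norm x0 \<le> 1 * norm x0"
        using h by (intro mult_right_mono) auto
      then have "(1 - h) *\<^sub>R x0 \<in> K"
        using h x0(1) by (simp add: K_def)
      from x0(2)[OF this] have "D (1 - h) \<le> D 1"
        using h by (simp add: D_def H_def)
      with e(2)[OF h(1,2)] show False
        by simp
    qed
    then have "\<bar>H x0\<bar> < \<epsilon>"
      using d(2)[of x0] s x0' by auto
    moreover have "0 \<le> \<epsilon> * norm x0"
      using \<epsilon> by simp
    ultimately show ?thesis
      using x0(2)[OF K(2)] by linarith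
  qed
  have "H z \<le> 0"
  proof (rule field_le_epsilon)
    fix e :: real assume "e > 0"
    define \<epsilon> where "\<epsilon> = e / (norm z + 1)"
    have pos: "norm z + 1 > 0"
      using norm_ge_zero[of z] by linarith
    then have "\<epsilon> > 0" "\<epsilon> * (norm z + 1) = e"
      using \<open>e > 0\<close> by (simp_all add: \<epsilon>_def)
    with key[of \<epsilon>] show "H z \<le> 0 + e"
      by (simp add: distrib_left)
  qed
  then show ?thesis
    using nz[OF z] z by (simp add: H_def ln_div algebra_simps)
qed

section \<open>Bounds for the quotient \<open>p\<close> in the class\<close>

lemma S_class_quotient:
  fixes f :: "complex^'n \<Rightarrow> complex^'n"
  assumes AB: "- 1 \<le> A" "A < B" "B \<le> 1" and \<alpha>: "0 \<le> \<alpha>" "\<alpha> < 1"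
    and g: "\<And>\<zeta>. \<zeta> \<in> ball 0 1 \<Longrightarrow> g \<zeta> = (1 + of_real A * \<zeta>) / (1 + of_real B * \<zeta>)"
    and f: "f \<in> S_class g \<alpha> \<beta>" and z: "z \<in> ball 0 1 - {0}"
  obtains h p w where "cjacobian f z *v h = f z" "p = hinner h z / of_real ((norm z)\<^sup>2)"
    "w = (- of_real \<alpha> + \<i> * of_real (tan \<beta>)) / of_real (1 - \<alpha>)
        + (1 - \<i> * of_real (tan \<beta>)) / of_real (1 - \<alpha>) * p"
    "(1 + A * norm z) / (1 + B * norm z) \<le> Re w" "Re w \<le> (1 - A * norm z) / (1 - B * norm z)"
    "cmod w \<le> (1 - A * norm z) / (1 - B * norm z)"
proof -
  define h where "h = (\<lambda>z. matrix_inv (cjacobian f z) *v f z)"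
  have "h \<in> M_class g \<alpha> \<beta>" and inv: "invertible (cjacobian f z)"
    using f z by (auto simp: S_class_def h_def)
  from M_class_Schwarz[OF g AB \<alpha>(2) this(1) z refl refl]
  have le: "cmod (1 - ((- of_real \<alpha> + \<i> * of_real (tan \<beta>)) / of_real (1 - \<alpha>)
        + (1 - \<i> * of_real (tan \<beta>)) / of_real (1 - \<alpha>) * (hinner (h z) z / of_real ((norm z)\<^sup>2))))
    \<le> norm z * cmod (of_real B * ((- of_real \<alpha> + \<i> * of_real (tan \<beta>)) / of_real (1 - \<alpha>)
        + (1 - \<i> * of_real (tan \<beta>)) / of_real (1 - \<alpha>) * (hinner (h z) z / of_real ((norm z)\<^sup>2))) - of_real A)" .
  have "norm z < 1"
    using z by simp
  note bounds = moebius_disc_bounds[OF AB norm_ge_zero this le]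
  have "cjacobian f z ** matrix_inv (cjacobian f z) = mat 1"
    using someI_ex[OF inv[unfolded invertible_def]] unfolding matrix_inv_def by blast
  then have "cjacobian f z *v h z = f z"
    by (simp add: h_def matrix_vector_mul_assoc)
  from that[OF this refl refl bounds] show thesis .
qed

text \<open>For real \<open>p\<close> the parameter \<beta> enters only the imaginary part of
  \<open>w\<close>; this is why the growth bounds do not depend on \<beta>.\<close>

lemma Re_tan_quotient:
  fixes \<alpha> \<beta> p :: real
  assumes "w = (- of_real \<alpha> + \<i> * of_real (tan \<beta>)) / of_real (1 - \<alpha>)
        + (1 - \<i> * of_real (tan \<beta>)) / of_real (1 - \<alpha>) * of_real p"
  shows "Re w = (p - \<alpha>) / (1 - \<alpha>)"
  unfolding assms by (simp add: diff_divide_distrib del: of_real_diff)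

text \<open>Solve for \<open>(1 - \<i> * tan \<beta>) * p\<close> and apply the triangle inequality;
  the coefficient has modulus \<open>1 / cos \<beta>\<close>. The right-hand side is the shape of
  \<open>digamma2\<close>.\<close>

lemma cmod_tan_quotient:
  fixes \<alpha> \<beta> p :: real
  assumes w: "w = (- of_real \<alpha> + \<i> * of_real (tan \<beta>)) / of_real (1 - \<alpha>)
        + (1 - \<i> * of_real (tan \<beta>)) / of_real (1 - \<alpha>) * of_real p"
    and \<alpha>: "\<alpha> < 1" and \<beta>: "cos \<beta> > 0"
  shows "\<bar>p\<bar> \<le> (cmod w + 1 / (1 - \<alpha>) * sqrt (\<alpha>\<^sup>2 + (tan \<beta>)\<^sup>2)) * (1 - \<alpha>) * cos \<beta>"
proof -
  define a where "a = - complex_of_real \<alpha> + \<i> * of_real (tan \<beta>)"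
  have a: "cmod a = sqrt (\<alpha>\<^sup>2 + (tan \<beta>)\<^sup>2)"
    by (simp add: a_def cmod_def)
  have nz: "complex_of_real (1 - \<alpha>) \<noteq> 0"
    using \<alpha> unfolding of_real_eq_0_iff by simp
  have "of_real (1 - \<alpha>) * w = a + (1 - \<i> * of_real (tan \<beta>)) * of_real p"
    unfolding w a_def distrib_left using nz by simp
  then have "(1 - \<i> * of_real (tan \<beta>)) * of_real p = of_real (1 - \<alpha>) * w - a"
    by simp
  then have "cmod (1 - \<i> * of_real (tan \<beta>)) * \<bar>p\<bar> = cmod (of_real (1 - \<alpha>) * w - a)"
    by (metis norm_mult norm_of_real)
  also have "\<dots> \<le> (1 - \<alpha>) * cmod w + cmod a"
    using norm_triangle_ineq4[of "of_real (1 - \<alpha>) * w" a] \<alpha>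
    unfolding norm_mult norm_of_real by simp
  finally have "cmod (1 - \<i> * of_real (tan \<beta>)) * \<bar>p\<bar> \<le> (1 - \<alpha>) * cmod w + cmod a" .
  moreover have "cmod (1 - \<i> * of_real (tan \<beta>)) = 1 / cos \<beta>"
  proof -
    have "(cmod (1 - \<i> * of_real (tan \<beta>)))\<^sup>2 = (1 / cos \<beta>)\<^sup>2"
      using tan_sec[of \<beta>] \<beta> by (simp add: cmod_power2 inverse_eq_divide power_divide)
    then show ?thesis
      using \<beta> by (simp add: power2_eq_iff_nonneg del: power_divide)
  qed
  ultimately have "\<bar>p\<bar> \<le> ((1 - \<alpha>) * cmod w + cmod a) * cos \<beta>"
    using \<beta> by (simp add: pos_divide_le_eq)
  also have "(1 - \<alpha>) * cmod w + cmod a = (cmod w + 1 / (1 - \<alpha>) * sqrt (\<alpha>\<^sup>2 + (tan \<beta>)\<^sup>2)) * (1 - \<alpha>)"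
    using \<alpha> unfolding a distrib_right by simp
  finally show ?thesis .
qed

text \<open>A zero of \<open>f\<close> would force \<open>h = 0\<close> and \<open>p = 0\<close>,
  hence \<open>Re w \<le> 0\<close>, whereas the disc for \<open>w\<close> lies in the open right
  half-plane.\<close>

lemma S_class_nonzero:
  fixes f :: "complex^'n \<Rightarrow> complex^'n"
  assumes AB: "- 1 \<le> A" "A < B" "B \<le> 1" and \<alpha>: "0 \<le> \<alpha>" "\<alpha> < 1"
    and g: "\<And>\<zeta>. \<zeta> \<in> ball 0 1 \<Longrightarrow> g \<zeta> = (1 + of_real A * \<zeta>) / (1 + of_real B * \<zeta>)"
    and f: "f \<in> S_class g \<alpha> \<beta>" and z: "z \<in> ball 0 1 - {0}"
  shows "f z \<noteq> 0"
proof
  assume fz: "f z = 0"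
  obtain h p w where h: "cjacobian f z *v h = f z" and p: "p = hinner h z / of_real ((norm z)\<^sup>2)"
    and w: "w = (- of_real \<alpha> + \<i> * of_real (tan \<beta>)) / of_real (1 - \<alpha>)
        + (1 - \<i> * of_real (tan \<beta>)) / of_real (1 - \<alpha>) * p"
    and le: "(1 + A * norm z) / (1 + B * norm z) \<le> Re w"
    by (rule S_class_quotient[OF AB \<alpha> g f z]) blast
  have "invertible (cjacobian f z)"
    using f z by (auto simp: S_class_def)
  then have "h = 0"
    using h fz by (metis matrix_left_invertible_ker invertible_def)
  then have "p = of_real 0"
    by (simp add: p hinner_def)
  from Re_tan_quotient[OF w[unfolded this]] have "Re w \<le> 0"
    using \<alpha> by (simp add: divide_nonpos_pos)
  moreover have "0 < (1 + A * norm z) / (1 + B * norm z)"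
    using one_plus_mult_pos(1)[of _ "norm z"] AB z by (intro divide_pos_pos) auto
  ultimately show False
    using le by simp
qed

text \<open>The first-order conditions make \<open>p\<close> a positive real number. The bounds with
  \<open>T\<close> come from \<open>Re w\<close> and serve the growth estimate; those with
  \<open>digamma1\<close> and \<open>digamma2\<close> serve the distortion estimate.\<close>

lemma S_class_extremum:
  fixes f :: "complex^'n \<Rightarrow> complex^'n"
  assumes AB: "- 1 \<le> A" "A < B" "B \<le> 1" and \<alpha>: "0 \<le> \<alpha>" "\<alpha> < 1"
    and \<beta>: "- (pi / 2) < \<beta>" "\<beta> < pi / 2"
    and g: "\<And>\<zeta>. \<zeta> \<in> ball 0 1 \<Longrightarrow> g \<zeta> = (1 + of_real A * \<zeta>) / (1 + of_real B * \<zeta>)"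
    and f: "f \<in> S_class g \<alpha> \<beta>" and z: "z \<in> ball 0 1 - {0}" and ext: "sphere_extremum f z"
    and T: "T = A - A * \<alpha> + B * \<alpha>"
  obtains h and p :: real where "p > 0" "cjacobian f z *v h = f z"
    "hinner h z = of_real (p * (norm z)\<^sup>2)"
    "Re (hinner (cjacobian f z *v z) (f z)) = (norm (f z))\<^sup>2 / p"
    "(1 + T * norm z) / (1 + B * norm z) \<le> p" "p \<le> (1 - T * norm z) / (1 - B * norm z)"
    "digamma1 A B \<alpha> \<beta> (norm z) > 0 \<Longrightarrow> digamma1 A B \<alpha> \<beta> (norm z) \<le> p"
    "p \<le> digamma2 A B \<alpha> \<beta> (norm z)"
proof -
  obtain h p w where h: "cjacobian f z *v h = f z" and p: "p = hinner h z / of_real ((norm z)\<^sup>2)"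
    and w: "w = (- of_real \<alpha> + \<i> * of_real (tan \<beta>)) / of_real (1 - \<alpha>)
        + (1 - \<i> * of_real (tan \<beta>)) / of_real (1 - \<alpha>) * p"
    and le: "(1 + A * norm z) / (1 + B * norm z) \<le> Re w" "Re w \<le> (1 - A * norm z) / (1 - B * norm z)"
      "cmod w \<le> (1 - A * norm z) / (1 - B * norm z)"
    by (rule S_class_quotient[OF AB \<alpha> g f z]) blast
  have "holomorphic_ball f"
    using f by (simp add: S_class_def)
  then have der: "(f has_derivative (\<lambda>v. cjacobian f z *v v)) (at z)"
    using z cjacobian_eq unfolding holomorphic_ball_def by blast
  have z0: "z \<noteq> 0"
    using z by simp
  define L where "L = Re (hinner (cjacobian f z *v z) (f z))"
  have L: "hinner (cjacobian f z *v z) (f z) = of_real L"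
    using sphere_extremum_real[OF ext z0 der] by (simp add: L_def)
  have pL: "p * of_real L = of_real ((norm (f z))\<^sup>2)"
    using sphere_extremum_quotient[OF ext z0 der h] by (simp only: p L)
  have fz: "f z \<noteq> 0"
    by (rule S_class_nonzero[OF AB \<alpha> g f z])
  have L0: "L \<noteq> 0"
    using pL fz by auto
  define q where "q = (norm (f z))\<^sup>2 / L"
  have "p = of_real ((norm (f z))\<^sup>2) / of_real L"
    using pL L0 by (simp add: eq_divide_eq del: of_real_power)
  then have pq: "p = of_real q"
    by (simp add: q_def)
  have pos: "0 < 1 + A * norm z" "0 < 1 - A * norm z" "0 < 1 + B * norm z" "0 < 1 - B * norm z"
    using one_plus_mult_pos[of _ "norm z"] AB z by auto
  have Re: "Re w = (q - \<alpha>) / (1 - \<alpha>)"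
    by (rule Re_tan_quotient[OF w[unfolded pq]])
  have "0 < (1 + A * norm z) / (1 + B * norm z)"
    using pos by simp
  with le(1) have "0 < (q - \<alpha>) / (1 - \<alpha>)"
    by (simp add: Re)
  then have q0: "q > 0"
    using \<alpha> by (simp add: zero_less_divide_iff)
  have hz: "hinner h z = of_real (q * (norm z)\<^sup>2)"
  proof -
    have "hinner h z = p * of_real ((norm z)\<^sup>2)"
      using z0 by (simp add: p)
    then show ?thesis
      by (simp add: pq)
  qed
  have Lq: "Re (hinner (cjacobian f z *v z) (f z)) = (norm (f z))\<^sup>2 / q"
    using L0 fz by (simp add: q_def L_def)
  have lower: "(1 - \<alpha>) * ((1 + A * norm z) / (1 + B * norm z)) + \<alpha> \<le> q"
    using le(1) \<alpha> by (simp add: Re pos_le_divide_eq mult.commute)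
  have upper: "q \<le> (1 - \<alpha>) * ((1 - A * norm z) / (1 - B * norm z)) + \<alpha>"
    using le(2) \<alpha> by (simp add: Re pos_divide_le_eq mult.commute)
  \<comment> \<open>Adding \<alpha> to \<open>1 - \<alpha>\<close> times the disc end point combines
    \<open>A\<close> and \<open>B\<close> into \<open>T\<close>.\<close>
  have bounds: "(1 + T * norm z) / (1 + B * norm z) \<le> q" "q \<le> (1 - T * norm z) / (1 - B * norm z)"
  proof -
    have "(1 - \<alpha>) * ((1 + A * norm z) / (1 + B * norm z)) + \<alpha> = (1 + T * norm z) / (1 + B * norm z)"
      using pos by (simp add: T add_divide_eq_iff divide_add_eq_iff) (simp add: algebra_simps)
    with lower show "(1 + T * norm z) / (1 + B * norm z) \<le> q"
      by simp
    have "(1 - \<alpha>) * ((1 - A * norm z) / (1 - B * norm z)) + \<alpha> = (1 - T * norm z) / (1 - B * norm z)"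
      using pos by (simp add: T add_divide_eq_iff divide_add_eq_iff) (simp add: algebra_simps)
    with upper show "q \<le> (1 - T * norm z) / (1 - B * norm z)"
      by simp
  qed
  have cos: "cos \<beta> > 0"
    using \<beta> by (intro cos_gt_zero_pi) auto
  \<comment> \<open>Up to the factor \<open>cos \<beta>\<close>, \<open>digamma1\<close> is the real
    lower bound with \<alpha> and the square root term discarded. Inserting
    \<open>cos \<beta> \<le> 1\<close> lowers the bound only if \<open>X\<close> is
    positive.\<close>
  have d1: "digamma1 A B \<alpha> \<beta> (norm z) \<le> q" if "digamma1 A B \<alpha> \<beta> (norm z) > 0"
  proof -
    define X where "X = ((1 + A * norm z) / (1 + B * norm z) - 1 / (1 - \<alpha>) * sqrt (\<alpha>\<^sup>2 + (tan \<beta>)\<^sup>2)) * (1 - \<alpha>)"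
    have X: "digamma1 A B \<alpha> \<beta> (norm z) = X * cos \<beta>"
      by (simp add: digamma1_def X_def)
    then have "X > 0"
      using that cos by (simp add: zero_less_mult_iff)
    then have "X * cos \<beta> \<le> X"
      by (simp add: mult_left_le)
    also have "X \<le> (1 + A * norm z) / (1 + B * norm z) * (1 - \<alpha>)"
      unfolding X_def using \<alpha> by (intro mult_right_mono) auto
    also have "\<dots> \<le> q"
      using lower \<alpha> by (simp add: mult.commute)
    finally show ?thesis
      by (simp add: X)
  qed
  have "q \<le> digamma2 A B \<alpha> \<beta> (norm z)"
  proof -
    have "\<bar>q\<bar> \<le> (cmod w + 1 / (1 - \<alpha>) * sqrt (\<alpha>\<^sup>2 + (tan \<beta>)\<^sup>2)) * (1 - \<alpha>) * cos \<beta>"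
      by (rule cmod_tan_quotient[OF w[unfolded pq] \<alpha>(2) cos])
    also have "\<dots> \<le> digamma2 A B \<alpha> \<beta> (norm z)"
      unfolding digamma2_def using le(3) \<alpha> cos by (intro mult_right_mono add_right_mono) auto
    finally show ?thesis
      by simp
  qed
  from that[OF q0 h hz Lq bounds d1 this] show thesis .
qed

section \<open>Growth of the norm in the class\<close>

text \<open>Where \<open>1 + T * x > 0\<close>, the solution with value 1 at \<open>x = 0\<close> of
  the equation with logarithmic derivative \<open>k / (1 + T * x)\<close>; the exponential is the
  limit case \<open>T = 0\<close>.\<close>

definition growth_factor :: "real \<Rightarrow> real \<Rightarrow> real \<Rightarrow> real" where
  "growth_factor k T x = (if T \<noteq> 0 then (1 + T * x) powr (k / T) else exp (k * x))"

lemma growth_factor_eq_exp: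
  assumes "0 < 1 + T * x"
  shows "growth_factor k T x = exp (if T \<noteq> 0 then k / T * ln (1 + T * x) else k * x)"
  using assms by (simp add: growth_factor_def powr_def)

lemma growth_factor_power:
  assumes "0 < 1 + T * x"
  shows "growth_factor k T x ^ n = growth_factor (real n * k) T x"
  using assms by (simp add: growth_factor_def powr_power exp_of_nat_mult[symmetric] mult_ac)

text \<open>This is \<open>growth_comparison\<close> for \<open>\<psi>\<close>, the logarithm of the
  growth factor: at a sphere extremum the logarithmic radial derivative of \<open>norm (f x)\<close>
  is \<open>1 / p\<close>.\<close>

lemma S_class_growth:
  fixes f :: "complex^'n \<Rightarrow> complex^'n"
  assumes AB: "- 1 \<le> A" "A < B" "B \<le> 1" and \<alpha>: "0 \<le> \<alpha>" "\<alpha> < 1"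
    and \<beta>: "- (pi / 2) < \<beta>" "\<beta> < pi / 2"
    and g: "\<And>\<zeta>. \<zeta> \<in> ball 0 1 \<Longrightarrow> g \<zeta> = (1 + of_real A * \<zeta>) / (1 + of_real B * \<zeta>)"
    and f: "f \<in> S_class g \<alpha> \<beta>" and z: "z \<in> ball 0 1 - {0}"
    and T: "T = A - A * \<alpha> + B * \<alpha>"
  shows "norm (f z) / norm z \<le> growth_factor (B - T) T (norm z)"
    "growth_factor (B - T) T (- norm z) \<le> norm (f z) / norm z"
proof -
  define \<psi> where "\<psi> = (\<lambda>x. if T \<noteq> 0 then (B - T) / T * ln (1 + T * x) else (B - T) * x)"
  have T1: "\<bar>T\<bar> \<le> 1"
    using abs_convex_combination_le_1[of A B \<alpha>] AB \<alpha> by (simp add: T)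
  have Tpos: "0 < 1 + T * t" if "\<bar>t\<bar> < 1" for t
    using one_plus_mult_pos[OF T1, of "\<bar>t\<bar>"] that by (cases "t \<ge> 0") auto
  have \<psi>: "(\<psi> has_real_derivative (B - T) / (1 + T * t)) (at t)" if "\<bar>t\<bar> < 1" for t
  proof (cases "T = 0")
    case True
    then show ?thesis
      unfolding \<psi>_def by (auto intro!: derivative_eq_intros)
  next
    case False
    then have "((\<lambda>x. (B - T) / T * ln (1 + T * x)) has_real_derivative (B - T) / (1 + T * t)) (at t)"
      using Tpos[OF that] by (auto intro!: derivative_eq_intros)
    with False show ?thesis
      by (simp add: \<psi>_def)
  qed
  have \<psi>0: "\<psi> 0 = 0"
    by (simp add: \<psi>_def)
  have holo: "holomorphic_ball f" and f0: "f 0 = 0" "cjacobian f 0 = mat 1"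
    using f by (auto simp: S_class_def)
  have nz: "f x \<noteq> 0" if "x \<in> ball 0 1 - {0}" for x
    by (rule S_class_nonzero[OF AB \<alpha> g f that])
  have growth: "\<sigma> * ln (norm (f z) / norm z) \<le> \<sigma> * \<psi> (\<sigma> * norm z)" if \<sigma>: "\<sigma> = 1 \<or> \<sigma> = -1" for \<sigma>
  proof (rule growth_comparison[OF \<sigma> holo f0 nz \<psi> \<psi>0 _ z])
    fix x :: "complex^'n"
    assume x: "x \<in> ball 0 1 - {0}"
      and "\<And>\<xi>. \<xi> \<in> sphere 0 (norm x) \<Longrightarrow> \<sigma> * norm (f \<xi>) \<le> \<sigma> * norm (f x)"
    then have "sphere_extremum f x"
      using \<sigma> by (auto simp: sphere_extremum_def)
    then obtain p :: real where p: "p > 0"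
      "Re (hinner (cjacobian f x *v x) (f x)) = (norm (f x))\<^sup>2 / p"
      "(1 + T * norm x) / (1 + B * norm x) \<le> p" "p \<le> (1 - T * norm x) / (1 - B * norm x)"
      using S_class_extremum[OF AB \<alpha> \<beta> g f x _ T] by metis
    have fx: "f x \<noteq> 0"
      by (rule nz[OF x])
    have pos: "0 < 1 + T * norm x" "0 < 1 - T * norm x" "0 < 1 + B * norm x" "0 < 1 - B * norm x"
      using one_plus_mult_pos[of _ "norm x"] AB T1 x by auto
    have up: "1 / p \<le> (1 + B * norm x) / (1 + T * norm x)"
      using p(1,3) pos by (simp add: field_simps)
    have lo: "(1 - B * norm x) / (1 - T * norm x) \<le> 1 / p"
      using p(1,4) pos by (simp add: field_simps)
    \<comment> \<open>Puts both bounds on \<open>1 / p\<close> into the form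
      \<open>1 + \<sigma> * norm x * \<psi>' (\<sigma> * norm x)\<close>.\<close>
    have eq: "(1 + B * norm x) / (1 + T * norm x) = 1 + norm x * ((B - T) / (1 + T * norm x))"
      "(1 - B * norm x) / (1 - T * norm x) = 1 - norm x * ((B - T) / (1 - T * norm x))"
      using pos by (simp_all add: field_simps)
    show "\<sigma> * (Re (hinner (cjacobian f x *v x) (f x)) / (norm (f x))\<^sup>2)
        \<le> \<sigma> * (1 + \<sigma> * norm x * ((B - T) / (1 + T * (\<sigma> * norm x))))"
      using \<sigma> up lo unfolding p(2) eq using fx by auto
  qed
  have pos: "0 < norm (f z) / norm z"
    using nz[OF z] z by simp
  have "norm z < 1"
    using z by simp
  then have exp_\<psi>: "growth_factor (B - T) T (norm z) = exp (\<psi> (norm z))"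
    "growth_factor (B - T) T (- norm z) = exp (\<psi> (- norm z))"
    using Tpos[of "norm z"] Tpos[of "- norm z"] by (simp_all add: growth_factor_eq_exp \<psi>_def)
  show "norm (f z) / norm z \<le> growth_factor (B - T) T (norm z)"
    using growth[of 1] pos unfolding exp_\<psi> by (subst exp_ln[OF pos, symmetric]) (simp del: exp_ln)
  show "growth_factor (B - T) T (- norm z) \<le> norm (f z) / norm z"
    using growth[of "-1"] pos unfolding exp_\<psi> by (subst exp_ln[OF pos, symmetric]) (simp del: exp_ln)
qed

text \<open>Source of the exponent \<open>(n + 1) / 2\<close>: each of the \<open>n\<close>
  directions contributes \<open>1 / sqrt p\<close>, and the determinant of the modification
  \<open>S\<close> contributes one more.\<close>

lemma power_divide_sqrt:
  fixes E p :: real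
  assumes "p > 0"
  shows "(E / sqrt p) ^ n / sqrt p = E ^ n * p powr (- ((real n + 1) / 2))"
proof -
  have "sqrt p ^ Suc n = p powr ((real n + 1) / 2)"
    using assms by (simp add: powr_half_sqrt[symmetric] powr_power add.commute del: power_Suc)
  moreover have "(E / sqrt p) ^ n / sqrt p = E ^ n / sqrt p ^ Suc n"
    by (simp add: power_divide mult.commute)
  ultimately show ?thesis
    by (simp only: powr_minus divide_inverse)
qed

lemma powr_minus_eq_recip:
  fixes d a :: real
  assumes "d > 0"
  shows "d powr (- a) = (1 / d) powr a"
  using assms by (simp add: powr_divide powr_minus_divide)

section \<open>Assembly of growth, tangential and determinant estimates\<close>

theorem theorem3p4:
  fixes A B \<alpha> \<beta> T :: real
    and g :: "complex \<Rightarrow> complex"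
    and f :: "complex^'n \<Rightarrow> complex^'n"
    and z :: "complex^'n"
  assumes "-1 \<le> A" and "A < B" and "B \<le> 1"
    and "0 \<le> \<alpha>" and "\<alpha> < 1"
    and "- (pi / 2) < \<beta>" and "\<beta> < pi / 2"
    and "\<And>\<zeta>. \<zeta> \<in> ball 0 1 \<Longrightarrow> g \<zeta> = (1 + of_real A * \<zeta>) / (1 + of_real B * \<zeta>)"
    and "f \<in> S_class g \<alpha> \<beta>"
    and "T = A - A * \<alpha> + B * \<alpha>"
    and "z \<in> ball 0 1 - {0}"
  shows
    "((\<forall>\<xi>\<in>sphere 0 (norm z). norm (f \<xi>) \<le> norm (f z)) \<and> digamma1 A B \<alpha> \<beta> (norm z) > 0 \<longrightarrow>
       norm (det (cjacobian f z)) \<le>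
         (if T \<noteq> 0
          then (1 + (A - A * \<alpha> + B * \<alpha>) * norm z)
                 powr (real CARD('n) * (B - A) * (1 - \<alpha>) / (A - A * \<alpha> + B * \<alpha>))
               * (1 / digamma1 A B \<alpha> \<beta> (norm z)) powr ((real CARD('n) + 1) / 2)
          else exp (real CARD('n) * (B - A) * (1 - \<alpha>) * norm z)
               * (1 / digamma1 A B \<alpha> \<beta> (norm z)) powr ((real CARD('n) + 1) / 2)) \<and>
       (\<forall>\<delta>\<in>hol_tangent z. norm (cjacobian f z *v \<delta>) \<le>
         (if T \<noteq> 0
          then (1 + (A - A * \<alpha> + B * \<alpha>) * norm z)
                 powr ((B - A) * (1 - \<alpha>) / (A - A * \<alpha> + B * \<alpha>))
               * (1 / digamma1 A B \<alpha> \<beta> (norm z)) powr (1 / 2) * norm \<delta>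
          else exp ((B - A) * (1 - \<alpha>) * norm z)
               * (1 / digamma1 A B \<alpha> \<beta> (norm z)) powr (1 / 2) * norm \<delta>)))
     \<and>
     ((\<forall>\<xi>\<in>sphere 0 (norm z). norm (f z) \<le> norm (f \<xi>)) \<longrightarrow>
       norm (det (cjacobian f z)) \<ge>
         (if T \<noteq> 0
          then (1 + (A * \<alpha> - A - B * \<alpha>) * norm z)
                 powr (real CARD('n) * (A - B) * (1 - \<alpha>) / (A * \<alpha> - B * \<alpha> - A))
               * digamma2 A B \<alpha> \<beta> (norm z) powr (- ((real CARD('n) + 1) / 2))
          else exp (real CARD('n) * (A - B) * (1 - \<alpha>) * norm z)
               * digamma2 A B \<alpha> \<beta> (norm z) powr (- ((real CARD('n) + 1) / 2))) \<and>
       (\<forall>\<delta>\<in>hol_tangent z. norm (cjacobian f z *v \<delta>) \<ge>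
         (if T \<noteq> 0
          then (1 + (A * \<alpha> - A - B * \<alpha>) * norm z)
                 powr ((A - B) * (1 - \<alpha>) / (A * \<alpha> - B * \<alpha> - A))
               * digamma2 A B \<alpha> \<beta> (norm z) powr (- (1 / 2)) * norm \<delta>
          else exp ((A - B) * (1 - \<alpha>) * norm z)
               * digamma2 A B \<alpha> \<beta> (norm z) powr (- (1 / 2)) * norm \<delta>)))"
proof -
  have AB: "- 1 \<le> A" "A < B" "B \<le> 1" and \<alpha>: "0 \<le> \<alpha>" "\<alpha> < 1"
    and \<beta>: "- (pi / 2) < \<beta>" "\<beta> < pi / 2"
    by fact+
  note g = assms(8) and f = assms(9) and T = assms(10) and z = assms(11)
  define r where "r = norm z"
  define M where "M = cjacobian f z"
  define N where "N = norm (f z)"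
  have r: "0 < r" "r < 1"
    using z by (auto simp: r_def)
  have z0: "z \<noteq> 0"
    using z by simp
  have holo: "holomorphic_ball f"
    using f by (simp add: S_class_def)
  then have der: "(f has_derivative (\<lambda>v. M *v v)) (at z)"
    using z cjacobian_eq unfolding holomorphic_ball_def M_def by blast
  have fz: "f z \<noteq> 0"
    by (rule S_class_nonzero[OF AB \<alpha> g f z])
  then have N: "N > 0"
    by (simp add: N_def)
  have k: "B - T = (B - A) * (1 - \<alpha>)"
    by (simp add: T algebra_simps)
  have growth: "N / r \<le> growth_factor (B - T) T r" "growth_factor (B - T) T (- r) \<le> N / r"
    using S_class_growth[OF AB \<alpha> \<beta> g f z T] by (simp_all add: N_def r_def)
  have T1: "\<bar>T\<bar> \<le> 1"
    using abs_convex_combination_le_1[of A B \<alpha>] AB \<alpha> by (simp add: T)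
  have Tpos: "0 < 1 + T * r" "0 < 1 + T * - r"
    using one_plus_mult_pos[OF T1, of r] r by auto
  have gf_pos: "growth_factor (B - T) T r > 0" "growth_factor (B - T) T (- r) > 0"
    using Tpos by (simp_all add: growth_factor_eq_exp)
  \<comment> \<open>Square root of the second-order inequality, once the radial derivative is
    written as \<open>N^2 / p\<close>.\<close>
  have sq: "X \<le> N / (r * sqrt p) * norm v" if "X\<^sup>2 * (norm z)\<^sup>2 \<le> N\<^sup>2 / p * (norm v)\<^sup>2" "p > 0"
    for X p and v :: "complex^'n"
  proof -
    have "(X * r)\<^sup>2 \<le> (N / sqrt p * norm v)\<^sup>2"
      using that by (simp add: power_mult_distrib power_divide r_def)
    then have "X * r \<le> N / sqrt p * norm v"
      by (rule power2_le_imp_le) (use N that(2) in simp)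
    then have "X \<le> N / sqrt p * norm v / r"
      using pos_le_divide_eq[OF r(1)] by blast
    then show ?thesis
      by (simp add: mult.commute)
  qed
  have sq': "N / (r * sqrt p) * norm v \<le> X" if "X\<^sup>2 * (norm z)\<^sup>2 \<ge> N\<^sup>2 / p * (norm v)\<^sup>2" "p > 0" "X \<ge> 0"
    for X p and v :: "complex^'n"
  proof -
    have "(N / sqrt p * norm v)\<^sup>2 \<le> (X * r)\<^sup>2"
      using that by (simp add: power_mult_distrib power_divide r_def)
    then have "N / sqrt p * norm v \<le> X * r"
      by (rule power2_le_imp_le) (use that(3) r in simp)
    then have "N / sqrt p * norm v / r \<le> X"
      using pos_divide_le_eq[OF r(1)] by blast
    then show ?thesis
      by (simp add: mult.commute)
  qed

  have upper: "cmod (det M) \<le> growth_factor (real CARD('n) * (B - T)) T r * (1 / d) powr ((real CARD('n) + 1) / 2) \<and>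
      (\<forall>v\<in>hol_tangent z. norm (M *v v) \<le> growth_factor (B - T) T r * (1 / d) powr (1 / 2) * norm v)"
    if max: "\<forall>\<xi>\<in>sphere 0 (norm z). norm (f \<xi>) \<le> norm (f z)"
      and d: "d = digamma1 A B \<alpha> \<beta> (norm z)" "d > 0" for d
  proof -
    have ext: "sphere_extremum f z"
      using max by (simp add: sphere_extremum_def)
    obtain h and p :: real where p: "p > 0" and h: "M *v h = f z"
      "hinner h z = of_real (p * (norm z)\<^sup>2)"
      and Re: "Re (hinner (M *v z) (f z)) = N\<^sup>2 / p" and dp: "d \<le> p"
      using S_class_extremum[OF AB \<alpha> \<beta> g f z ext T] d unfolding M_def N_def by metis
    have tan: "norm (M *v v) \<le> N / (r * sqrt p) * norm v" if "hinner v z = 0" for v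
      using sphere_max_tangent_le[OF holo z der _ that] max p by (intro sq) (simp_all add: Re)
    have "cmod (det M) * sqrt p \<le> (N / (r * sqrt p)) ^ CARD('n)"
      using extremal_det_le[OF z0 fz sphere_extremum_perp[OF ext z0 der] h(1) p h(2)] tan
      by (simp add: N_def r_def)
    then have "cmod (det M) \<le> (N / r / sqrt p) ^ CARD('n) / sqrt p"
      using p by (simp add: pos_le_divide_eq)
    also have "\<dots> = (N / r) ^ CARD('n) * p powr (- ((real CARD('n) + 1) / 2))"
      by (rule power_divide_sqrt[OF p])
    \<comment> \<open>The exponent is negative, so replacing \<open>p\<close> by the smaller
      \<open>d\<close> enlarges the factor.\<close>
    also have "\<dots> \<le> growth_factor (B - T) T r ^ CARD('n) * d powr (- ((real CARD('n) + 1) / 2))"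
      using growth(1) N r dp d(2) gf_pos by (intro mult_mono power_mono powr_mono2') auto
    also have "d powr (- ((real CARD('n) + 1) / 2)) = (1 / d) powr ((real CARD('n) + 1) / 2)"
      using d(2) by (rule powr_minus_eq_recip)
    finally have "cmod (det M) \<le> growth_factor (real CARD('n) * (B - T)) T r * (1 / d) powr ((real CARD('n) + 1) / 2)"
      by (simp only: growth_factor_power[OF Tpos(1)])
    moreover have "norm (M *v v) \<le> growth_factor (B - T) T r * (1 / d) powr (1 / 2) * norm v"
      if "v \<in> hol_tangent z" for v
    proof -
      have "norm (M *v v) \<le> N / r * (1 / sqrt p) * norm v"
        using tan[of v] that by (simp add: hol_tangent_iff)
      also have "\<dots> \<le> growth_factor (B - T) T r * (1 / sqrt d) * norm v"
        using growth(1) N r dp d(2) p gf_pos by (intro mult_mono mult_right_mono frac_le) auto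
      also have "1 / sqrt d = (1 / d) powr (1 / 2)"
        using d(2) by (simp add: powr_half_sqrt real_sqrt_divide)
      finally show ?thesis .
    qed
    ultimately show ?thesis
      by blast
  qed

  have lower: "cmod (det M) \<ge> growth_factor (real CARD('n) * (B - T)) T (- r) * d powr (- ((real CARD('n) + 1) / 2)) \<and>
      (\<forall>v\<in>hol_tangent z. norm (M *v v) \<ge> growth_factor (B - T) T (- r) * d powr (- (1 / 2)) * norm v)"
    if min: "\<forall>\<xi>\<in>sphere 0 (norm z). norm (f z) \<le> norm (f \<xi>)"
      and d: "d = digamma2 A B \<alpha> \<beta> (norm z)" for d
  proof -
    have ext: "sphere_extremum f z"
      using min by (simp add: sphere_extremum_def)
    obtain h and p :: real where p: "p > 0" and h: "M *v h = f z"
      "hinner h z = of_real (p * (norm z)\<^sup>2)"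
      and Re: "Re (hinner (M *v z) (f z)) = N\<^sup>2 / p" and dp: "p \<le> d"
      using S_class_extremum[OF AB \<alpha> \<beta> g f z ext T] d unfolding M_def N_def by metis
    have tan: "norm (M *v v) \<ge> N / (r * sqrt p) * norm v" if "hinner v z = 0" for v
      using sphere_min_tangent_ge[OF holo z der _ that] min p by (intro sq') (simp_all add: Re)
    have "growth_factor (B - T) T (- r) ^ CARD('n) * d powr (- ((real CARD('n) + 1) / 2))
        \<le> (N / r) ^ CARD('n) * p powr (- ((real CARD('n) + 1) / 2))"
      using growth(2) N r dp p gf_pos by (intro mult_mono power_mono powr_mono2') auto
    also have "\<dots> = (N / r / sqrt p) ^ CARD('n) / sqrt p"
      by (rule power_divide_sqrt[OF p, symmetric])
    also have "\<dots> \<le> cmod (det M)"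
      using extremal_det_ge[OF z0 fz sphere_extremum_perp[OF ext z0 der] h(1) p h(2)] tan p
      by (simp add: N_def r_def pos_divide_le_eq)
    finally have "growth_factor (real CARD('n) * (B - T)) T (- r) * d powr (- ((real CARD('n) + 1) / 2)) \<le> cmod (det M)"
      by (simp only: growth_factor_power[OF Tpos(2)])
    moreover have "growth_factor (B - T) T (- r) * d powr (- (1 / 2)) * norm v \<le> norm (M *v v)"
      if "v \<in> hol_tangent z" for v
    proof -
      \<comment> \<open>Positivity of \<open>d\<close> follows from \<open>0 < p\<close> and
        \<open>p \<le> d\<close>, whereas the upper estimate assumes it.\<close>
      have "d powr (- (1 / 2)) = 1 / sqrt d"
        using p dp powr_minus_eq_recip[of d "1 / 2"] by (simp add: powr_half_sqrt real_sqrt_divide)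
      then have "growth_factor (B - T) T (- r) * d powr (- (1 / 2)) * norm v
          = growth_factor (B - T) T (- r) * (1 / sqrt d) * norm v"
        by simp
      also have "\<dots> \<le> N / r * (1 / sqrt p) * norm v"
        using growth(2) N r dp p gf_pos by (intro mult_mono mult_right_mono frac_le) auto
      also have "\<dots> \<le> norm (M *v v)"
        using tan[of v] that by (simp add: hol_tangent_iff)
      finally show ?thesis .
    qed
    ultimately show ?thesis
      by blast
  qed

  \<comment> \<open>Both exponents are covered: \<open>m = CARD('n)\<close> for the determinant and
    \<open>m = 1\<close> for tangent vectors.\<close>
  have gf: "growth_factor (real m * (B - T)) T r
      = (if T \<noteq> 0 then (1 + (A - A * \<alpha> + B * \<alpha>) * norm z) powr (real m * (B - A) * (1 - \<alpha>) / (A - A * \<alpha> + B * \<alpha>))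
         else exp (real m * (B - A) * (1 - \<alpha>) * norm z))" for m
    unfolding growth_factor_def k by (simp add: r_def T[symmetric] mult.assoc)
  have gf': "growth_factor (real m * (B - T)) T (- r)
      = (if T \<noteq> 0 then (1 + (A * \<alpha> - A - B * \<alpha>) * norm z) powr (real m * (A - B) * (1 - \<alpha>) / (A * \<alpha> - B * \<alpha> - A))
         else exp (real m * (A - B) * (1 - \<alpha>) * norm z))" for m
  proof -
    \<comment> \<open>The stated lower bounds carry both numerator and denominator of the exponent
      with reversed sign.\<close>
    have "A * \<alpha> - A - B * \<alpha> = - T" "A * \<alpha> - B * \<alpha> - A = - T" "real m * (A - B) * (1 - \<alpha>) = - (real m * (B - T))"
      by (simp_all add: T algebra_simps)
    then show ?thesis
      by (simp only: growth_factor_def r_def minus_divide_divide) simp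
  qed
  show ?thesis
    using upper[OF _ refl] lower[OF _ refl] gf[of "CARD('n)"] gf[of 1] gf'[of "CARD('n)"] gf'[of 1]
    unfolding M_def[symmetric] by (cases "T = 0") simp_all
qed

end
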